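(* Let $f\in\mathcal{S}$ and let $\Gamma_1,\Gamma_2,\Gamma_3$ be the initial logarithmic coefficients of its inverse function $f^{-1}$. Then the following inequalities hold, and each of them is sharp: (i) $|\Gamma_1|\le 1$; (ii) $|\Gamma_2|\le \frac{3}{2}$; (iii) $|\Gamma_3|\le \frac{10}{3}$.
   Context: Let $\mathbb{D}=\{z\in\mathbb{C}:|z|<1\}$. $\mathcal{A}$ is the class of functions $f$ analytic in $\mathbb{D}$ of the form $f(z)=z+a_2z^2+a_3z^3+\cdots$, and $\mathcal{S}$ is the subclass of $\mathcal{A}$ of functions univalent (injective) in $\mathbb{D}$. By Koebe's $1/4$ theorem, each $f\in\mathcal{S}$ has an inverse $f^{-1}$ defined at least on the disk $|w|<1/4$, with expansion $f^{-1}(w)=w+A_2w^2+A_3w^3+\cdots$. The logarithmic coefficients $\Gamma_n$ of $f^{-1}$ are defined by $\log\frac{f^{-1}(w)}{w}=2\sum_{n=1}^\infty\Gamma_n w^n$ for $w$ near $0$ (branch of the logarithm vanishing at $w=0$). An inequality is called sharp if equality holds for at least one function $f$ in the class considered. *)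

theory Defs
  imports "HOL-Complex_Analysis.Complex_Analysis"
begin

abbreviation unit_disk :: "complex set"  (\<open>\<bbbD>\<close>)
  where "\<bbbD> \<equiv> ball 0 1"

text \<open>
  Functions are total in HOL; only the values on \<open>\<bbbD>\<close> matter, here and in everything below.
  The conditions at \<open>0\<close> say that the Taylor expansion starts as \<open>z + a\<^sub>2 z\<^sup>2 + \<dots>\<close>.
\<close>

definition class_A :: "(complex \<Rightarrow> complex) set"
  where "class_A = {f. f holomorphic_on \<bbbD> \<and> f 0 = 0 \<and> deriv f 0 = 1}"

definition class_S :: "(complex \<Rightarrow> complex) set"
  where "class_S = {f \<in> class_A. inj_on f \<bbbD>}"

definition disk_inverse :: "(complex \<Rightarrow> complex) \<Rightarrow> complex \<Rightarrow> complex"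
  where "disk_inverse f = inv_into \<bbbD> f"

text \<open>
  For \<open>f\<close> in \<open>class_S\<close> the quotient \<open>f\<^sup>-\<^sup>1(w)/w\<close> tends to \<open>1\<close> as \<open>w\<close> tends to \<open>0\<close>, so near \<open>0\<close> the
  principal logarithm gives the analytic branch vanishing at \<open>0\<close> (where the singularity is removed
  explicitly). Further away from \<open>0\<close> the function below may be discontinuous; only its germ at \<open>0\<close>
  is used.
\<close>

definition log_inverse_quot :: "(complex \<Rightarrow> complex) \<Rightarrow> complex \<Rightarrow> complex"
  where "log_inverse_quot f w = (if w = 0 then 0 else Ln (disk_inverse f w / w))"

definition inv_log_coeff :: "(complex \<Rightarrow> complex) \<Rightarrow> nat \<Rightarrow> complex"
  where "inv_log_coeff f n = fps_nth (fps_expansion (log_inverse_quot f) 0) n / 2"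

text \<open>
  The Taylor expansion in the previous definition converges to the function near \<open>0\<close>, so that the
  coefficients are those of the defining relation
  \<open>log (f\<^sup>-\<^sup>1(w)/w) = 2 \<Sum>\<^sub>n\<^sub>\<ge>\<^sub>1 \<Gamma>\<^sub>n w\<^sup>n\<close>.
\<close>

lemma log_inverse_quot_analytic:
  assumes "f \<in> class_S"
  shows "log_inverse_quot f analytic_on {0}"
proof -
  have hol: "f holomorphic_on \<bbbD>" and f0: "f 0 = 0" and df: "deriv f 0 = 1" and inj: "inj_on f \<bbbD>"
    using assms by (auto simp: class_S_def class_A_def)
  obtain g where g: "g holomorphic_on f ` \<bbbD>"
      and dg: "\<And>z. z \<in> \<bbbD> \<Longrightarrow> deriv f z * deriv g (f z) = 1"
      and gf: "\<And>z. z \<in> \<bbbD> \<Longrightarrow> g (f z) = z"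
    using holomorphic_has_inverse[OF hol _ inj] by auto
  have op: "open (f ` \<bbbD>)"
    using open_mapping_thm3[OF hol _ inj] by simp
  have g0: "g 0 = 0" and dg0: "deriv g 0 = 1"
    using gf[of 0] dg[of 0] f0 df by auto
  have g_eq: "disk_inverse f w = g w" if "w \<in> f ` \<bbbD>" for w
    using that gf inj by (auto simp: disk_inverse_def inv_into_f_f)
  have zero: "0 \<in> f ` \<bbbD>"
    using f0 by (force intro: image_eqI[of _ _ 0])
  define q where "q = (\<lambda>w. if w = 0 then deriv g 0 else (g w - g 0) / (w - 0))"
  have "q holomorphic_on f ` \<bbbD>"
    unfolding q_def by (rule pole_lemma_open[OF g op])
  then have "q analytic_on {0}"
    using op zero by (auto simp: analytic_at)
  moreover have "q 0 = 1"
    by (simp add: q_def dg0)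
  ultimately have "(\<lambda>w. Ln (q w)) analytic_on {0}"
    by (intro analytic_intros) auto
  moreover have "eventually (\<lambda>w. Ln (q w) = log_inverse_quot f w) (nhds 0)"
    using eventually_nhds_in_open[OF op zero]
    by eventually_elim (auto simp: log_inverse_quot_def q_def g_eq g0 dg0)
  ultimately show ?thesis
    using analytic_at_cong[OF _ refl] by metis
qed

lemma inv_log_coeff_0: "inv_log_coeff f 0 = 0"
  by (simp add: inv_log_coeff_def fps_expansion_def log_inverse_quot_def)

lemma inv_log_coeff_sums:
  assumes "f \<in> class_S"
  shows "eventually (\<lambda>w. (\<lambda>n. 2 * (inv_log_coeff f (Suc n) * w ^ Suc n)) sums
           Ln (disk_inverse f w / w)) (at 0)"
proof -
  obtain r where r: "r > 0" "log_inverse_quot f holomorphic_on ball 0 r"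
    using log_inverse_quot_analytic[OF assms] by (auto simp: analytic_on_def)
  have "eventually (\<lambda>w. w \<in> ball 0 r \<and> w \<noteq> 0) (at (0::complex))"
    using eventually_at_in_open[of "ball 0 r" "0::complex"] r by auto
  then show ?thesis
  proof eventually_elim
    case (elim w)
    then have "(\<lambda>n. 2 * (inv_log_coeff f n * w ^ n)) sums Ln (disk_inverse f w / w)"
      using holomorphic_power_series[OF r(2), of w]
      by (simp add: inv_log_coeff_def fps_expansion_def log_inverse_quot_def)
    then show ?case
      by (subst sums_Suc_iff) (simp add: inv_log_coeff_0)
  qed
qed

end

theory Submission
  imports Defs
begin

text \<open>
  Write \<open>f(z) = z / p(z)\<close> with \<open>p(z) = 1 + b\<^sub>0 z + b\<^sub>1 z\<^sup>2 + b\<^sub>2 z\<^sup>3 + \<dots>\<close>. The substitution \<open>w = f(z)\<close> turns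
  \<open>log (f\<^sup>-\<^sup>1(w)/w)\<close> into \<open>log p(z)\<close>, and comparing coefficients gives \<open>2 \<Gamma>\<^sub>1 = b\<^sub>0\<close>, \<open>4 \<Gamma>\<^sub>2 = b\<^sub>0\<^sup>2 + 2 b\<^sub>1\<close> and
  \<open>6 \<Gamma>\<^sub>3 = b\<^sub>0\<^sup>3 + 6 b\<^sub>0 b\<^sub>1 + 3 b\<^sub>2\<close> (\<open>inv_log_coeff_formulas\<close>). It therefore suffices to prove
  \<open>\<bar>b\<^sub>0\<bar> \<le> 2\<close>, \<open>\<bar>b\<^sub>1\<bar> \<le> 1\<close> and \<open>\<bar>12 b\<^sub>2 + b\<^sub>0\<^sup>3\<bar> \<le> 8\<close> (\<open>quotient_coefficient_bounds\<close>), because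
  \<open>b\<^sub>0\<^sup>3 + 6 b\<^sub>0 b\<^sub>1 + 3 b\<^sub>2 = (12 b\<^sub>2 + b\<^sub>0\<^sup>3)/4 + 3/4 b\<^sub>0\<^sup>3 + 6 b\<^sub>0 b\<^sub>1\<close>, and the three terms are at most
  \<open>2\<close>, \<open>6\<close> and \<open>12\<close> in modulus. For the Koebe function \<open>p(z) = (1 - z)\<^sup>2\<close>, and equality holds throughout.

  All three bounds are cases of the diagonal Grunsky inequality \<open>\<bar>h\<^sub>n\<^sub>n\<bar> \<le> 1/n\<close>, where
  \<open>h\<^sub>k\<^sub>l\<close> is the coefficient of \<open>z\<^sup>k w\<^sup>l\<close> in \<open>log ((F(w) - F(z))/(w - z))\<close> for an injective holomorphic \<open>F\<close> on the
  disk (\<open>diagonal_grunsky\<close>). With \<open>F = f\<close> one has \<open>h\<^sub>1\<^sub>1 = -b\<^sub>1\<close>; with the odd function \<open>F(z)\<close> whose square is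
  \<open>f(z\<^sup>2)\<close> one has \<open>h\<^sub>1\<^sub>1 = -b\<^sub>0/2\<close> and \<open>h\<^sub>3\<^sub>3 = -(12 b\<^sub>2 + b\<^sub>0\<^sup>3)/24\<close>.

  The Grunsky inequality is a statement about electrostatic energy: for a charge distribution of total
  charge zero, the double integral of \<open>log \<bar>w - w'\<bar>\<close> is never positive (\<open>neutral_log_energy_nonpos\<close>). Put the
  charge density \<open>cos (n t + \<alpha>)\<close> at the points \<open>F(r e\<^sup>i\<^sup>t)\<close>. Splitting \<open>log \<bar>F(z) - F(w)\<bar>\<close> into \<open>log \<bar>z - w\<bar>\<close> and the
  real part of \<open>log ((F(z) - F(w))/(z - w))\<close>, the first part contributes \<open>-\<pi>\<^sup>2/n\<close> and the second
  \<open>\<pi>\<^sup>2 r\<^sup>2\<^sup>n Re (e\<^sup>-\<^sup>2\<^sup>i\<^sup>\<alpha> h\<^sub>n\<^sub>n)\<close>; now choose \<open>\<alpha>\<close> well and let \<open>r\<close> tend to \<open>1\<close>. The sign of the energy is elementary: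
  up to terms that a neutral charge does not see, \<open>-log (\<epsilon> + \<bar>w - w'\<bar>\<^sup>2)\<close> has the form \<open>-log (1 - x)\<close> with
  \<open>x\<close> an inner product kernel, and \<open>-log (1 - x)\<close> is a power series in \<open>x\<close> with nonnegative coefficients.
\<close>

section \<open>Logarithmic energy of a neutral charge\<close>

lemma abs_mult_le:
  fixes a b :: real
  assumes "\<bar>a\<bar> \<le> A" "\<bar>b\<bar> \<le> B"
  shows "\<bar>a * b\<bar> \<le> A * B"
  using mult_mono[OF assms order_trans[OF abs_ge_zero assms(1)] abs_ge_zero] by (simp add: abs_mult)

lemma (in finite_measure) integrable_pair_bounded:
  fixes f :: "'a \<times> 'a \<Rightarrow> real"
  assumes "f \<in> borel_measurable (M \<Otimes>\<^sub>M M)"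
    and "\<And>x y. x \<in> space M \<Longrightarrow> y \<in> space M \<Longrightarrow> \<bar>f (x, y)\<bar> \<le> B"
  shows "integrable (M \<Otimes>\<^sub>M M) f"
proof -
  interpret P: finite_measure "M \<Otimes>\<^sub>M M"
    by (intro finite_measure_pair_measure finite_measure_axioms)
  show ?thesis
    by (rule P.integrable_const_bound[where B = B]) (use assms in \<open>auto simp: space_pair_measure\<close>)
qed

lemma (in finite_measure) integral_pair_mult:
  fixes f g :: "'a \<Rightarrow> real"
  assumes "integrable M f" "integrable M g"
  shows "(\<integral>p. f (fst p) * g (snd p) \<partial>(M \<Otimes>\<^sub>M M)) = (\<integral>x. f x \<partial>M) * (\<integral>x. g x \<partial>M)"
proof -
  interpret pair_sigma_finite M M
    by unfold_locales
  note [measurable] = borel_measurable_integrable[OF assms(1)] borel_measurable_integrable[OF assms(2)]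
  have int: "integrable (M \<Otimes>\<^sub>M M) (\<lambda>(x, y). f x * g y)"
    by (rule Fubini_integrable) (use assms in \<open>auto simp: abs_mult\<close>)
  show ?thesis
    using integral_fst[OF int] by (simp add: case_prod_unfold)
qed

text \<open>
  Powers of an inner product kernel are positive semidefinite. One factor of the power can be absorbed
  into the weight, turning \<open>\<phi>\<close> into the functions \<open>u i * \<phi>\<close>, so induction applies once \<open>\<phi>\<close> is arbitrary.
\<close>

lemma (in finite_measure) product_power_kernel_nonneg:
  fixes u :: "'i \<Rightarrow> 'a \<Rightarrow> real"
  assumes I: "finite I"
    and u: "\<And>i. i \<in> I \<Longrightarrow> u i \<in> borel_measurable M"
    and ub: "\<And>i x. i \<in> I \<Longrightarrow> x \<in> space M \<Longrightarrow> \<bar>u i x\<bar> \<le> B"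
    and \<phi>: "\<phi> \<in> borel_measurable M"
    and \<phi>b: "\<And>x. x \<in> space M \<Longrightarrow> \<bar>\<phi> x\<bar> \<le> C"
  shows "0 \<le> (\<integral>p. (\<Sum>i\<in>I. u i (fst p) * u i (snd p)) ^ k * (\<phi> (fst p) * \<phi> (snd p)) \<partial>(M \<Otimes>\<^sub>M M))"
  using \<phi> \<phi>b
proof (induction k arbitrary: \<phi> C)
  case 0
  have "integrable M \<phi>"
    by (rule integrable_const_bound[where B = C]) (use 0 in auto)
  then show ?case
    by (simp add: integral_pair_mult)
next
  case (Suc k)
  note [measurable] = u Suc.prems(1)
  define S where "S p = (\<Sum>i\<in>I. u i (fst p) * u i (snd p))" for p
  have S_meas [measurable]: "S \<in> borel_measurable (M \<Otimes>\<^sub>M M)"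
    unfolding S_def by measurable
  have Sb: "\<bar>S (x, y)\<bar> \<le> real (card I) * (B * B)" if "x \<in> space M" "y \<in> space M" for x y
  proof -
    have "\<bar>S (x, y)\<bar> \<le> (\<Sum>i\<in>I. \<bar>u i x * u i y\<bar>)"
      unfolding S_def by (simp add: sum_abs)
    also have "\<dots> \<le> (\<Sum>i\<in>I. B * B)"
      using ub that by (intro sum_mono abs_mult_le) auto
    finally show ?thesis by simp
  qed
  have ub': "\<bar>u i x * \<phi> x\<bar> \<le> B * C" if "i \<in> I" "x \<in> space M" for i x
    by (intro abs_mult_le ub Suc.prems(2) that)
  have step: "0 \<le> (\<integral>p. S p ^ k * ((u i (fst p) * \<phi> (fst p)) * (u i (snd p) * \<phi> (snd p))) \<partial>(M \<Otimes>\<^sub>M M))"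
    if "i \<in> I" for i
    unfolding S_def using Suc.IH[of "\<lambda>x. u i x * \<phi> x" "B * C"] ub'[OF that] that by simp
  have int: "integrable (M \<Otimes>\<^sub>M M) (\<lambda>p. S p ^ k * ((u i (fst p) * \<phi> (fst p)) * (u i (snd p) * \<phi> (snd p))))"
    if "i \<in> I" for i
  proof (rule integrable_pair_bounded)
    fix x y assume xy: "x \<in> space M" "y \<in> space M"
    have 1: "\<bar>S (x, y) ^ k\<bar> \<le> (real (card I) * (B * B)) ^ k"
      unfolding power_abs by (intro power_mono Sb xy) auto
    have 2: "\<bar>(u i x * \<phi> x) * (u i y * \<phi> y)\<bar> \<le> (B * C) * (B * C)"
      by (rule abs_mult_le[OF ub'[OF that xy(1)] ub'[OF that xy(2)]])
    show "\<bar>S (x, y) ^ k * ((u i (fst (x, y)) * \<phi> (fst (x, y))) * (u i (snd (x, y)) * \<phi> (snd (x, y))))\<bar>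
        \<le> (real (card I) * (B * B)) ^ k * ((B * C) * (B * C))"
      using abs_mult_le[OF 1 2] by simp
  qed (use that in measurable)
  have "(\<integral>p. S p ^ Suc k * (\<phi> (fst p) * \<phi> (snd p)) \<partial>(M \<Otimes>\<^sub>M M)) =
        (\<integral>p. (\<Sum>i\<in>I. S p ^ k * ((u i (fst p) * \<phi> (fst p)) * (u i (snd p) * \<phi> (snd p)))) \<partial>(M \<Otimes>\<^sub>M M))"
    by (rule Bochner_Integration.integral_cong)
       (simp_all add: S_def sum_distrib_left sum_distrib_right mult_ac)
  also have "\<dots> = (\<Sum>i\<in>I. \<integral>p. S p ^ k * ((u i (fst p) * \<phi> (fst p)) * (u i (snd p) * \<phi> (snd p))) \<partial>(M \<Otimes>\<^sub>M M))"
    by (intro Bochner_Integration.integral_sum int)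
  also have "\<dots> \<ge> 0"
    by (intro sum_nonneg step)
  finally show ?case
    unfolding S_def .
qed

text \<open>
  A neutral charge does not see a kernel of the form \<open>a(x) + a(y)\<close>; this allows kernels to be
  renormalised freely by such terms.
\<close>

lemma (in finite_measure) neutral_integral_separable:
  fixes a b \<phi> :: "'a \<Rightarrow> real"
  assumes [measurable]: "a \<in> borel_measurable M" "\<phi> \<in> borel_measurable M"
    and ab: "\<And>x. x \<in> space M \<Longrightarrow> \<bar>a x\<bar> \<le> B"
    and \<phi>b: "\<And>x. x \<in> space M \<Longrightarrow> \<bar>\<phi> x\<bar> \<le> C"
    and neutral: "(\<integral>x. \<phi> x \<partial>M) = 0"
  shows "(\<integral>p. (a (fst p) + a (snd p)) * (\<phi> (fst p) * \<phi> (snd p)) \<partial>(M \<Otimes>\<^sub>M M)) = 0"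
proof -
  have \<phi>i: "integrable M \<phi>"
    by (rule integrable_const_bound[where B = C]) (use \<phi>b in auto)
  have prod: "\<bar>a x * \<phi> x\<bar> \<le> B * C" if "x \<in> space M" for x
    by (intro abs_mult_le ab \<phi>b that)
  have a\<phi>i: "integrable M (\<lambda>x. a x * \<phi> x)"
    by (rule integrable_const_bound[where B = "B * C"]) (use prod in auto)
  have bd: "\<bar>a x * \<phi> x * \<phi> y\<bar> \<le> (B * C) * C" if "x \<in> space M" "y \<in> space M" for x y
    by (intro abs_mult_le prod \<phi>b that)
  have "(\<integral>p. (a (fst p) + a (snd p)) * (\<phi> (fst p) * \<phi> (snd p)) \<partial>(M \<Otimes>\<^sub>M M)) =
     (\<integral>p. (a (fst p) * \<phi> (fst p)) * \<phi> (snd p) + \<phi> (fst p) * (a (snd p) * \<phi> (snd p)) \<partial>(M \<Otimes>\<^sub>M M))"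
    by (rule Bochner_Integration.integral_cong) (simp_all add: algebra_simps)
  also have "\<dots> = (\<integral>p. (a (fst p) * \<phi> (fst p)) * \<phi> (snd p) \<partial>(M \<Otimes>\<^sub>M M))
      + (\<integral>p. \<phi> (fst p) * (a (snd p) * \<phi> (snd p)) \<partial>(M \<Otimes>\<^sub>M M))"
  proof (rule Bochner_Integration.integral_add; rule integrable_pair_bounded[where B = "B * C * C"])
    show "\<bar>\<phi> (fst (x, y)) * (a (snd (x, y)) * \<phi> (snd (x, y)))\<bar> \<le> B * C * C"
      if "x \<in> space M" "y \<in> space M" for x y
      using bd[OF that(2,1)] by (simp add: mult_ac)
  qed (use bd in auto)
  also have "\<dots> = 0"
    using integral_pair_mult[OF a\<phi>i \<phi>i] integral_pair_mult[OF \<phi>i a\<phi>i] neutral by simp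
  finally show ?thesis .
qed

lemma neg_ln_one_minus_sums:
  fixes x :: real
  assumes "\<bar>x\<bar> < 1"
  shows "(\<lambda>k. x ^ Suc k / Suc k) sums (- ln (1 - x))"
proof -
  have "(\<lambda>k. - ((- (- x)) ^ k) / of_nat k) sums ln (1 + (- x))"
    using assms by (intro ln_series') auto
  then have "(\<lambda>k. - (x ^ k) / k) sums ln (1 - x)"
    by simp
  then have "(\<lambda>k. x ^ k / k) sums - ln (1 - x)"
    using sums_minus by fastforce
  then show ?thesis
    by (subst sums_Suc_iff) simp
qed

text \<open>
  Integrate the series \<open>-log (1 - x) = \<Sum> x\<^sup>k/k\<close> termwise; every term has a nonnegative integral. The uniform bound
  \<open>\<rho> < 1\<close> provides the dominating constant.
\<close>

lemma (in finite_measure) neutral_log_one_minus_kernel: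
  fixes u :: "'i \<Rightarrow> 'a \<Rightarrow> real"
  assumes I: "finite I"
    and u: "\<And>i. i \<in> I \<Longrightarrow> u i \<in> borel_measurable M"
    and ub: "\<And>i x. i \<in> I \<Longrightarrow> x \<in> space M \<Longrightarrow> \<bar>u i x\<bar> \<le> B"
    and \<phi> [measurable]: "\<phi> \<in> borel_measurable M"
    and \<phi>b: "\<And>x. x \<in> space M \<Longrightarrow> \<bar>\<phi> x\<bar> \<le> C"
    and \<rho>: "\<rho> < 1"
    and small: "\<And>x y. x \<in> space M \<Longrightarrow> y \<in> space M \<Longrightarrow> \<bar>\<Sum>i\<in>I. u i x * u i y\<bar> \<le> \<rho>"
  shows "(\<integral>p. ln (1 - (\<Sum>i\<in>I. u i (fst p) * u i (snd p))) * (\<phi> (fst p) * \<phi> (snd p)) \<partial>(M \<Otimes>\<^sub>M M)) \<le> 0"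
proof (cases "space M = {}")
  case True
  then have "space (M \<Otimes>\<^sub>M M) = {}"
    by (simp add: space_pair_measure)
  then show ?thesis
    by (simp add: Bochner_Integration.integral_empty)
next
  case False
  then obtain x0 where x0: "x0 \<in> space M" by auto
  have \<rho>0: "\<rho> \<ge> 0" using small[OF x0 x0] by linarith
  have C0: "C \<ge> 0" using \<phi>b[OF x0] by linarith
  note [measurable] = u
  define S where "S p = (\<Sum>i\<in>I. u i (fst p) * u i (snd p))" for p
  define \<psi> where "\<psi> p = \<phi> (fst p) * \<phi> (snd p)" for p
  have S_meas [measurable]: "S \<in> borel_measurable (M \<Otimes>\<^sub>M M)"
    unfolding S_def by measurable
  have \<psi>_meas [measurable]: "\<psi> \<in> borel_measurable (M \<Otimes>\<^sub>M M)"
    unfolding \<psi>_def by measurable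
  have Sb: "\<bar>S p\<bar> \<le> \<rho>" if "p \<in> space (M \<Otimes>\<^sub>M M)" for p
    using that small by (auto simp: S_def space_pair_measure)
  have \<psi>b: "\<bar>\<psi> p\<bar> \<le> C * C" if "p \<in> space (M \<Otimes>\<^sub>M M)" for p
    using that \<phi>b by (auto simp: \<psi>_def space_pair_measure intro!: abs_mult_le)
  define T where "T N p = (\<Sum>k<N. S p ^ Suc k / Suc k) * \<psi> p" for N p
  interpret P: finite_measure "M \<Otimes>\<^sub>M M"
    by (intro finite_measure_pair_measure finite_measure_axioms)
  have "(\<lambda>N. integral\<^sup>L (M \<Otimes>\<^sub>M M) (T N)) \<longlonglongrightarrow> (\<integral>p. - ln (1 - S p) * \<psi> p \<partial>(M \<Otimes>\<^sub>M M))"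
  proof (rule integral_dominated_convergence[where w = "\<lambda>_. - ln (1 - \<rho>) * (C * C)"])
    show "AE p in M \<Otimes>\<^sub>M M. (\<lambda>N. T N p) \<longlonglongrightarrow> - ln (1 - S p) * \<psi> p"
    proof (rule AE_I2)
      fix p assume "p \<in> space (M \<Otimes>\<^sub>M M)"
      then have "\<bar>S p\<bar> < 1" using Sb[of p] \<rho> by simp
      from neg_ln_one_minus_sums[OF this]
      show "(\<lambda>N. T N p) \<longlonglongrightarrow> - ln (1 - S p) * \<psi> p"
        unfolding T_def sums_def by (intro tendsto_mult tendsto_const)
    qed
    fix N
    show "AE p in M \<Otimes>\<^sub>M M. norm (T N p) \<le> - ln (1 - \<rho>) * (C * C)"
    proof (rule AE_I2)
      fix p assume p: "p \<in> space (M \<Otimes>\<^sub>M M)"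
      have "\<bar>\<Sum>k<N. S p ^ Suc k / Suc k\<bar> \<le> (\<Sum>k<N. \<bar>S p ^ Suc k / Suc k\<bar>)"
        by (rule sum_abs)
      also have "\<dots> \<le> (\<Sum>k<N. \<rho> ^ Suc k / Suc k)"
        unfolding abs_divide power_abs
        by (intro sum_mono divide_mono power_mono Sb p) auto
      also have "\<dots> \<le> - ln (1 - \<rho>)"
        using sum_le_suminf[of "\<lambda>k. \<rho> ^ Suc k / Suc k" "{..<N}"] neg_ln_one_minus_sums[of \<rho>] \<rho> \<rho>0
        by (simp add: sums_iff)
      finally show "norm (T N p) \<le> - ln (1 - \<rho>) * (C * C)"
        unfolding T_def real_norm_def using \<psi>b[OF p] by (intro abs_mult_le)
    qed
  qed (simp_all add: T_def[abs_def])
  moreover have "integral\<^sup>L (M \<Otimes>\<^sub>M M) (T N) \<ge> 0" for N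
  proof -
    have nn: "0 \<le> (\<integral>p. S p ^ Suc k * \<psi> p \<partial>(M \<Otimes>\<^sub>M M))" for k
      unfolding S_def \<psi>_def by (rule product_power_kernel_nonneg[OF I u ub \<phi> \<phi>b])
    have int: "integrable (M \<Otimes>\<^sub>M M) (\<lambda>p. S p ^ Suc k * \<psi> p)" for k
    proof (rule P.integrable_const_bound[where B = "\<rho> ^ Suc k * (C * C)"])
      show "AE p in M \<Otimes>\<^sub>M M. norm (S p ^ Suc k * \<psi> p) \<le> \<rho> ^ Suc k * (C * C)"
        unfolding real_norm_def
        by (intro AE_I2 abs_mult_le \<psi>b) (auto simp: power_abs simp del: power_Suc intro!: power_mono Sb)
    qed simp
    have "integral\<^sup>L (M \<Otimes>\<^sub>M M) (T N) = (\<integral>p. (\<Sum>k<N. (S p ^ Suc k * \<psi> p) / Suc k) \<partial>(M \<Otimes>\<^sub>M M))"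
      by (simp add: T_def[abs_def] sum_distrib_right)
    also have "\<dots> = (\<Sum>k<N. (\<integral>p. S p ^ Suc k * \<psi> p \<partial>(M \<Otimes>\<^sub>M M)) / Suc k)"
      by (subst Bochner_Integration.integral_sum) (use int in auto)
    also have "\<dots> \<ge> 0"
      by (intro sum_nonneg divide_nonneg_nonneg nn) auto
    finally show ?thesis .
  qed
  ultimately have "0 \<le> (\<integral>p. - ln (1 - S p) * \<psi> p \<partial>(M \<Otimes>\<^sub>M M))"
    by (intro LIMSEQ_le_const) auto
  then show ?thesis
    by (simp add: S_def \<psi>_def)
qed

text \<open>
  With \<open>d(x) = \<epsilon> + \<bar>w(x)\<bar>\<^sup>2\<close> one has the identity
  \<open>\<epsilon> (\<epsilon> + \<bar>w(x) - w(y)\<bar>\<^sup>2) = d(x) d(y) - 2 \<epsilon> Re (w(x) cnj (w(y))) - \<bar>w(x)\<bar>\<^sup>2 \<bar>w(y)\<bar>\<^sup>2\<close>. Dividing by \<open>d(x) d(y)\<close> exhibits the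
  left-hand side as \<open>1\<close> minus an inner product kernel with three components, while the logarithm of
  \<open>d(x) d(y)\<close> is invisible to a neutral charge.
\<close>

lemma (in finite_measure) neutral_log_energy_nonpos:
  fixes w :: "'a \<Rightarrow> complex"
  assumes w [measurable]: "w \<in> borel_measurable M"
    and wb: "\<And>x. x \<in> space M \<Longrightarrow> cmod (w x) \<le> W"
    and \<phi> [measurable]: "\<phi> \<in> borel_measurable M"
    and \<phi>b: "\<And>x. x \<in> space M \<Longrightarrow> \<bar>\<phi> x\<bar> \<le> C"
    and neutral: "(\<integral>x. \<phi> x \<partial>M) = 0"
    and \<epsilon>: "\<epsilon> > 0"
  shows "(\<integral>p. ln (\<epsilon> + (cmod (w (fst p) - w (snd p)))\<^sup>2) * (\<phi> (fst p) * \<phi> (snd p)) \<partial>(M \<Otimes>\<^sub>M M)) \<le> 0"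
proof (cases "space M = {}")
  case True
  then have "space (M \<Otimes>\<^sub>M M) = {}"
    by (simp add: space_pair_measure)
  then show ?thesis
    by (simp add: Bochner_Integration.integral_empty)
next
  case False
  then obtain x0 where x0: "x0 \<in> space M" by auto
  have W0: "W \<ge> 0" using order_trans[OF norm_ge_zero wb[OF x0]] .
  define d where "d x = \<epsilon> + (cmod (w x))\<^sup>2" for x
  define D where "D = \<epsilon> + W\<^sup>2"
  have d_ge: "d x \<ge> \<epsilon>" and d_pos: "d x > 0" for x
    using \<epsilon> by (auto simp: d_def add_pos_nonneg)
  have d_le: "d x \<le> D" if "x \<in> space M" for x
    using wb[OF that] by (simp add: d_def D_def power_mono)
  have d_meas [measurable]: "d \<in> borel_measurable M"
    unfolding d_def by measurable
  \<comment> \<open>the three components of the inner product kernel; the factor \<open>2 \<epsilon>\<close> in the identity for \<open>1 - S\<close>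
    is split evenly between the two points\<close>
  define u where "u = (\<lambda>(i::nat) x. if i = 0 then sqrt (2 * \<epsilon>) * Re (w x) / d x
      else if i = 1 then sqrt (2 * \<epsilon>) * Im (w x) / d x else (cmod (w x))\<^sup>2 / d x)"
  have u_meas: "u i \<in> borel_measurable M" for i
    unfolding u_def by measurable
  define S where "S x y = (\<Sum>i\<in>{0,1,2::nat}. u i x * u i y)" for x y
  have S_eq: "S x y = (2 * \<epsilon> * (w x \<bullet> w y) + (cmod (w x))\<^sup>2 * (cmod (w y))\<^sup>2) / (d x * d y)" for x y
  proof -
    have "S x y = ((sqrt (2 * \<epsilon>))\<^sup>2 * (w x \<bullet> w y) + (cmod (w x))\<^sup>2 * (cmod (w y))\<^sup>2) / (d x * d y)"
      using d_pos[of x] d_pos[of y]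
      by (simp add: S_def u_def inner_complex_def field_simps power2_eq_square del: real_sqrt_pow2 real_sqrt_mult)
    then show ?thesis using \<epsilon> by simp
  qed
  have dd: "d x * d y = \<epsilon>\<^sup>2 + \<epsilon> * ((cmod (w x))\<^sup>2 + (cmod (w y))\<^sup>2) + (cmod (w x))\<^sup>2 * (cmod (w y))\<^sup>2" for x y
    by (simp add: d_def algebra_simps power2_eq_square)
  have dist: "(cmod (w x - w y))\<^sup>2 = (cmod (w x))\<^sup>2 + (cmod (w y))\<^sup>2 - 2 * (w x \<bullet> w y)" for x y
    by (simp add: power2_norm_eq_inner inner_diff inner_commute)
  have one_minus: "1 - S x y = \<epsilon> * (\<epsilon> + (cmod (w x - w y))\<^sup>2) / (d x * d y)" for x y
  proof -
    have "1 - S x y = (d x * d y - (2 * \<epsilon> * (w x \<bullet> w y) + (cmod (w x))\<^sup>2 * (cmod (w y))\<^sup>2)) / (d x * d y)"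
      unfolding S_eq using d_pos[of x] d_pos[of y] by (simp add: diff_divide_distrib)
    also have "d x * d y - (2 * \<epsilon> * (w x \<bullet> w y) + (cmod (w x))\<^sup>2 * (cmod (w y))\<^sup>2)
        = \<epsilon> * (\<epsilon> + (cmod (w x - w y))\<^sup>2)"
      unfolding dd dist by (simp add: algebra_simps power2_eq_square)
    finally show ?thesis .
  qed
  have small: "\<bar>S x y\<bar> \<le> 1 - \<epsilon>\<^sup>2 / D\<^sup>2" if "x \<in> space M" "y \<in> space M" for x y
  proof -
    have "\<bar>w x \<bullet> w y\<bar> \<le> cmod (w x) * cmod (w y)"
      by (rule Cauchy_Schwarz_ineq2)
    then have "2 * \<bar>w x \<bullet> w y\<bar> \<le> (cmod (w x))\<^sup>2 + (cmod (w y))\<^sup>2"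
      using sum_squares_bound[of "cmod (w x)" "cmod (w y)"] by linarith
    then have "\<epsilon> * (2 * \<bar>w x \<bullet> w y\<bar>) \<le> \<epsilon> * ((cmod (w x))\<^sup>2 + (cmod (w y))\<^sup>2)"
      using \<epsilon> by (intro mult_left_mono) auto
    moreover have "\<bar>2 * \<epsilon> * (w x \<bullet> w y) + (cmod (w x))\<^sup>2 * (cmod (w y))\<^sup>2\<bar>
        \<le> \<epsilon> * (2 * \<bar>w x \<bullet> w y\<bar>) + (cmod (w x))\<^sup>2 * (cmod (w y))\<^sup>2"
      using \<epsilon> by (intro order_trans[OF abs_triangle_ineq]) (auto simp: abs_mult)
    ultimately have "\<bar>2 * \<epsilon> * (w x \<bullet> w y) + (cmod (w x))\<^sup>2 * (cmod (w y))\<^sup>2\<bar> \<le> d x * d y - \<epsilon>\<^sup>2"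
      unfolding dd by linarith
    then have "\<bar>S x y\<bar> \<le> (d x * d y - \<epsilon>\<^sup>2) / (d x * d y)"
      unfolding S_eq abs_divide using d_pos[of x] d_pos[of y] by (simp add: divide_right_mono)
    also have "\<dots> = 1 - \<epsilon>\<^sup>2 / (d x * d y)"
      using d_pos[of x] d_pos[of y] by (simp add: diff_divide_distrib)
    also have "\<dots> \<le> 1 - \<epsilon>\<^sup>2 / D\<^sup>2"
    proof -
      have "d x * d y \<le> D\<^sup>2"
        unfolding power2_eq_square using d_pos[of y] d_le[OF that(1)] d_le[OF that(2)] d_pos[of x]
        by (intro mult_mono) auto
      then show ?thesis
        using d_pos[of x] d_pos[of y] by (simp add: frac_le)
    qed
    finally show ?thesis .
  qed
  have ub: "\<bar>u i x\<bar> \<le> sqrt (2 * \<epsilon>) * W / \<epsilon> + 1" if "x \<in> space M" for i x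
  proof -
    have *: "\<bar>sqrt (2 * \<epsilon>) * v / d x\<bar> \<le> sqrt (2 * \<epsilon>) * W / \<epsilon>" if "\<bar>v\<bar> \<le> W" for v
      unfolding abs_divide abs_mult using that \<epsilon> d_ge[of x] d_pos[of x] by (intro frac_le mult_mono) auto
    have "\<bar>Re (w x)\<bar> \<le> W" "\<bar>Im (w x)\<bar> \<le> W"
      using wb[OF that] abs_Re_le_cmod abs_Im_le_cmod order_trans by blast+
    from *[OF this(1)] *[OF this(2)] show ?thesis
      using d_pos[of x] \<epsilon> W0 by (auto simp: u_def d_def add_increasing)
  qed
  have D_pos: "D > 0" using d_pos[of x0] d_le[OF x0] by linarith
  have main: "(\<integral>p. ln (1 - S (fst p) (snd p)) * (\<phi> (fst p) * \<phi> (snd p)) \<partial>(M \<Otimes>\<^sub>M M)) \<le> 0"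
    unfolding S_def
  proof (rule neutral_log_one_minus_kernel[OF _ _ _ \<phi> \<phi>b])
    show "1 - \<epsilon>\<^sup>2 / D\<^sup>2 < 1" using D_pos \<epsilon> by simp
  qed (use u_meas ub small in \<open>auto simp: S_def\<close>)
  have ln_eq: "ln (\<epsilon> + (cmod (w x - w y))\<^sup>2) = ln (1 - S x y) + ((ln (d x) - ln \<epsilon> / 2) + (ln (d y) - ln \<epsilon> / 2))"
    for x y
  proof -
    have "\<epsilon> + (cmod (w x - w y))\<^sup>2 > 0" using \<epsilon> by (simp add: add_pos_nonneg)
    then show ?thesis
      unfolding one_minus using d_pos[of x] d_pos[of y] \<epsilon> by (simp add: ln_mult ln_div)
  qed
  let ?\<psi> = "\<lambda>p. \<phi> (fst p) * \<phi> (snd p)"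
  have S_meas [measurable]: "(\<lambda>p. S (fst p) (snd p)) \<in> borel_measurable (M \<Otimes>\<^sub>M M)"
    unfolding S_eq by measurable
  \<comment> \<open>the constant \<open>ln \<epsilon>\<close> from the factor \<open>\<epsilon>\<close> in \<open>one_minus\<close> is shared by the two points\<close>
  define a where "a x = ln (d x) - ln \<epsilon> / 2" for x
  have a_meas [measurable]: "a \<in> borel_measurable M"
    unfolding a_def by measurable
  define A where "A = \<bar>ln \<epsilon>\<bar> + \<bar>ln D\<bar> + \<bar>ln \<epsilon> / 2\<bar>"
  have ab: "\<bar>a x\<bar> \<le> A" if "x \<in> space M" for x
  proof -
    have "ln \<epsilon> \<le> ln (d x)" "ln (d x) \<le> ln D"
      using d_ge[of x] d_le[OF that] \<epsilon> d_pos[of x] D_pos by auto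
    then show ?thesis unfolding a_def A_def by linarith
  qed
  have lnb: "\<bar>ln (1 - S x y)\<bar> \<le> \<bar>ln (\<epsilon>\<^sup>2 / D\<^sup>2)\<bar> + ln 2" if "x \<in> space M" "y \<in> space M" for x y
  proof -
    have "\<epsilon>\<^sup>2 / D\<^sup>2 \<le> 1 - S x y" "1 - S x y \<le> 2"
      using small[OF that] divide_nonneg_nonneg[OF zero_le_power2[of \<epsilon>] zero_le_power2[of D]] by linarith+
    moreover have "\<epsilon>\<^sup>2 / D\<^sup>2 > 0" using \<epsilon> D_pos by simp
    ultimately have "ln (\<epsilon>\<^sup>2 / D\<^sup>2) \<le> ln (1 - S x y)" "ln (1 - S x y) \<le> ln 2"
      by (auto intro!: ln_mono)
    then show ?thesis
      using ln_ge_zero[of "2::real"] by linarith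
  qed
  have "(\<integral>p. ln (\<epsilon> + (cmod (w (fst p) - w (snd p)))\<^sup>2) * ?\<psi> p \<partial>(M \<Otimes>\<^sub>M M))
      = (\<integral>p. ln (1 - S (fst p) (snd p)) * ?\<psi> p + (a (fst p) + a (snd p)) * ?\<psi> p \<partial>(M \<Otimes>\<^sub>M M))"
    unfolding ln_eq a_def by (simp only: distrib_right)
  also have "\<dots> = (\<integral>p. ln (1 - S (fst p) (snd p)) * ?\<psi> p \<partial>(M \<Otimes>\<^sub>M M))
      + (\<integral>p. (a (fst p) + a (snd p)) * ?\<psi> p \<partial>(M \<Otimes>\<^sub>M M))"
  proof (rule Bochner_Integration.integral_add)
    show "integrable (M \<Otimes>\<^sub>M M) (\<lambda>p. ln (1 - S (fst p) (snd p)) * ?\<psi> p)"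
    proof (rule integrable_pair_bounded)
      fix x y assume xy: "x \<in> space M" "y \<in> space M"
      show "\<bar>ln (1 - S (fst (x, y)) (snd (x, y))) * (\<phi> (fst (x, y)) * \<phi> (snd (x, y)))\<bar>
          \<le> (\<bar>ln (\<epsilon>\<^sup>2 / D\<^sup>2)\<bar> + ln 2) * (C * C)"
        unfolding fst_conv snd_conv by (intro abs_mult_le lnb \<phi>b xy)
    qed measurable
    show "integrable (M \<Otimes>\<^sub>M M) (\<lambda>p. (a (fst p) + a (snd p)) * ?\<psi> p)"
    proof (rule integrable_pair_bounded)
      fix x y assume xy: "x \<in> space M" "y \<in> space M"
      have "\<bar>a x + a y\<bar> \<le> A + A"
        using ab[OF xy(1)] ab[OF xy(2)] by linarith
      then show "\<bar>(a (fst (x, y)) + a (snd (x, y))) * (\<phi> (fst (x, y)) * \<phi> (snd (x, y)))\<bar>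
          \<le> (A + A) * (C * C)"
        unfolding fst_conv snd_conv by (intro abs_mult_le \<phi>b xy)
    qed measurable
  qed
  also have "\<dots> \<le> 0"
    using main neutral_integral_separable[OF a_meas \<phi> ab \<phi>b neutral] by simp
  finally show ?thesis .
qed

section \<open>Fourier integrals over a circle\<close>

text \<open>
  A finite measure on the type of reals, so that the energy lemma above applies to curves parametrised by
  the angle.
\<close>

definition angle_measure :: "real measure"
  where "angle_measure = restrict_space lborel {0..2 * pi}"

lemma space_angle_measure [simp]: "space angle_measure = {0..2 * pi}"
  by (simp add: angle_measure_def space_restrict_space)

lemma finite_measure_angle_measure: "finite_measure angle_measure"
  by (rule finite_measureI) (simp add: angle_measure_def space_restrict_space emeasure_restrict_space)

lemma borel_measurable_angle_measure:
  "f \<in> borel_measurable borel \<Longrightarrow> f \<in> borel_measurable angle_measure"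
  unfolding angle_measure_def by (intro measurable_restrict_space1) auto

lemma has_integral_angle_measure:
  fixes f :: "real \<Rightarrow> real"
  assumes "continuous_on {0..2 * pi} f" "(f has_integral I) {0..2 * pi}"
  shows "(\<integral>t. f t \<partial>angle_measure) = I"
proof -
  have "set_integrable lborel {0..2 * pi} f"
    by (rule borel_integrable_atLeastAtMost') (rule assms)
  from set_borel_integral_eq_integral(2)[OF this] assms(2) show ?thesis
    by (simp add: angle_measure_def integral_restrict_space set_lebesgue_integral_def integral_unique)
qed

text \<open>
  Fourier coefficients along a circle are Taylor coefficients, by Cauchy's formula for higher derivatives;
  those of negative index vanish by Cauchy's theorem.
\<close>

lemma circle_fourier_coeff:
  assumes hol: "N holomorphic_on ball 0 R" and r: "0 < r" "r < R"
  shows "((\<lambda>t. N (of_real r * cis t) * cis (- (real k * t)))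
      has_integral 2 * pi * r ^ k * fps_nth (fps_expansion N 0) k) {0..2 * pi}"
proof -
  have "((\<lambda>u. N u / (u - 0) ^ Suc k) has_contour_integral
      (2 * pi * \<i> / fact k * (deriv ^^ k) N 0)) (circlepath 0 r)"
  proof (rule Cauchy_has_contour_integral_higher_derivative_circlepath)
    have "cball 0 r \<subseteq> ball (0::complex) R" "ball 0 r \<subseteq> ball (0::complex) R" using r by auto
    then show "continuous_on (cball 0 r) N" "N holomorphic_on ball 0 r"
      using holomorphic_on_subset[OF hol] holomorphic_on_imp_continuous_on by blast+
  qed (use r in auto)
  then have "((\<lambda>t. N (r * cis t) / (r * cis t) ^ Suc k * r * \<i> * cis t) has_integral
      (2 * pi * \<i> / fact k * (deriv ^^ k) N 0)) {0..2 * pi}"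
    by (simp add: circlepath_def has_contour_integral_part_circlepath_iff del: power_Suc)
  then have "((\<lambda>t. (r ^ k / \<i>) * (N (r * cis t) / (r * cis t) ^ Suc k * r * \<i> * cis t)) has_integral
      (r ^ k / \<i>) * (2 * pi * \<i> / fact k * (deriv ^^ k) N 0)) {0..2 * pi}"
    by (rule has_integral_mult_right)
  also have "(\<lambda>t. (r ^ k / \<i>) * (N (r * cis t) / (r * cis t) ^ Suc k * r * \<i> * cis t))
      = (\<lambda>t. N (r * cis t) * cis (- (real k * t)))"
  proof
    fix t
    have "cis (real k * t) * cis (- (real k * t)) = 1"
      by (simp add: cis_mult)
    then show "(r ^ k / \<i>) * (N (r * cis t) / (r * cis t) ^ Suc k * r * \<i> * cis t)
      = N (r * cis t) * cis (- (real k * t))"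
      using r by (simp add: field_simps Complex.DeMoivre power_mult_distrib)
  qed
  finally show ?thesis
    by (simp add: fps_expansion_def mult_ac)
qed

lemma circle_fourier_coeff_neg:
  assumes hol: "N holomorphic_on ball 0 R" and r: "0 < r" "r < R" and k: "k \<ge> 1"
  shows "((\<lambda>t. N (of_real r * cis t) * cis (real k * t)) has_integral 0) {0..2 * pi}"
proof -
  have "((\<lambda>u. N u * u ^ (k - 1)) has_contour_integral 0) (circlepath 0 r)"
    by (rule Cauchy_theorem_convex_simple[of _ "ball 0 R"])
       (use r hol in \<open>auto intro!: holomorphic_intros\<close>)
  then have "((\<lambda>t. N (r * cis t) * (r * cis t) ^ (k - 1) * r * \<i> * cis t) has_integral 0) {0..2 * pi}"
    by (simp add: circlepath_def has_contour_integral_part_circlepath_iff)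
  then have "((\<lambda>t. (1 / (\<i> * r ^ k)) * (N (r * cis t) * (r * cis t) ^ (k - 1) * r * \<i> * cis t))
      has_integral (1 / (\<i> * r ^ k)) * 0) {0..2 * pi}"
    by (rule has_integral_mult_right)
  also have "(\<lambda>t. (1 / (\<i> * r ^ k)) * (N (r * cis t) * (r * cis t) ^ (k - 1) * r * \<i> * cis t))
      = (\<lambda>t. N (r * cis t) * cis (real k * t))"
  proof
    fix t
    obtain j where j: "k = Suc j" using k by (cases k) auto
    have "cis (real k * t) = cis t ^ j * cis t"
      by (simp add: j Complex.DeMoivre cis_mult algebra_simps)
    then show "(1 / (\<i> * r ^ k)) * (N (r * cis t) * (r * cis t) ^ (k - 1) * r * \<i> * cis t)
      = N (r * cis t) * cis (real k * t)"
      using r j by (simp add: field_simps power_mult_distrib)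
  qed
  finally show ?thesis by simp
qed

text \<open>
  Without Fourier coefficient of index \<open>-n\<close> only one of the two exponentials in the cosine survives.
\<close>

lemma integral_Re_times_cos:
  assumes cont: "continuous_on {0..2 * pi} g"
    and pos: "((\<lambda>t. g t * cis (- (real n * t))) has_integral A) {0..2 * pi}"
    and neg: "((\<lambda>t. g t * cis (real n * t)) has_integral 0) {0..2 * pi}"
  shows "(\<integral>t. Re (g t) * cos (real n * t + \<alpha>) \<partial>angle_measure) = Re (cis (- \<alpha>) * A) / 2"
proof (rule has_integral_angle_measure)
  have "((\<lambda>t. cis (- \<alpha>) / 2 * (g t * cis (- (real n * t))) + cis \<alpha> / 2 * (g t * cis (real n * t)))
      has_integral cis (- \<alpha>) / 2 * A + cis \<alpha> / 2 * 0) {0..2 * pi}"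
    by (intro has_integral_add has_integral_mult_right pos neg)
  from has_integral_Re[OF this]
  have "((\<lambda>t. Re (cis (- \<alpha>) / 2 * (g t * cis (- (real n * t))) + cis \<alpha> / 2 * (g t * cis (real n * t))))
      has_integral Re (cis (- \<alpha>) * A) / 2) {0..2 * pi}"
    by simp
  also have "(\<lambda>t. Re (cis (- \<alpha>) / 2 * (g t * cis (- (real n * t))) + cis \<alpha> / 2 * (g t * cis (real n * t))))
      = (\<lambda>t. Re (g t) * cos (real n * t + \<alpha>))"
    by (rule ext) (simp add: cos_add field_simps)
  finally show "((\<lambda>t. Re (g t) * cos (real n * t + \<alpha>)) has_integral Re (cis (- \<alpha>) * A) / 2) {0..2 * pi}" .
qed (intro continuous_intros cont)

lemma continuous_on_holomorphic_circle:
  assumes "N holomorphic_on ball 0 R" "0 < r" "r < R"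
  shows "continuous_on A (\<lambda>t. N (of_real r * cis t))"
  by (rule continuous_on_compose2[OF holomorphic_on_imp_continuous_on[OF assms(1)]])
     (use assms in \<open>auto intro!: continuous_intros simp: norm_mult\<close>)

lemma integral_Re_holomorphic_times_cos:
  assumes hol: "H holomorphic_on ball 0 R" and r: "0 < r" "r < R" and n: "n \<ge> 1"
  shows "(\<integral>t. Re (H (of_real r * cis t)) * cos (real n * t + \<alpha>) \<partial>angle_measure)
      = pi * r ^ n * Re (cis (- \<alpha>) * fps_nth (fps_expansion H 0) n)"
  by (subst integral_Re_times_cos[OF continuous_on_holomorphic_circle[OF hol r]
        circle_fourier_coeff[OF hol r] circle_fourier_coeff_neg[OF hol r n]])
     (simp add: algebra_simps)

text \<open>
  The function \<open>N(z)/z\<^sup>n\<close> may have a pole at \<open>0\<close>, but of order less than \<open>n\<close> since \<open>N(0) = 0\<close>, and this is enough for its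
  Fourier coefficient of index \<open>-n\<close> to vanish. This covers Taylor coefficients that are known through a formula with
  negative powers of \<open>z\<close>, whatever cancellation happens at \<open>0\<close>.
\<close>

lemma integral_Re_quotient_times_cos:
  assumes hol: "N holomorphic_on ball 0 R" and N0: "N 0 = 0" and r: "0 < r" "r < R" and n: "n \<ge> 1"
  shows "(\<integral>t. Re (N (of_real r * cis t) / (of_real r * cis t) ^ n) * cos (real n * t + \<alpha>) \<partial>angle_measure)
      = pi * r ^ n * Re (cis (- \<alpha>) * fps_nth (fps_expansion N 0) (2 * n))"
proof -
  define g where "g t = N (of_real r * cis t) / (of_real r * cis t) ^ n" for t
  have g1: "g t * cis (- (real n * t)) = (1 / r ^ n) * (N (of_real r * cis t) * cis (- (real (2 * n) * t)))" for t
  proof -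
    have "cis (- (real (2 * n) * t)) = cis (- (real n * t)) * cis (- (real n * t))"
      by (simp add: cis_mult algebra_simps)
    moreover have "cis (real n * t) * cis (- (real n * t)) = 1"
      by (simp add: cis_mult)
    ultimately show ?thesis
      using r by (simp add: g_def power_mult_distrib Complex.DeMoivre field_simps)
  qed
  have g2: "g t * cis (real n * t) = (1 / r ^ n) * (N (of_real r * cis t) * cis (- (real 0 * t)))" for t
    using r by (simp add: g_def power_mult_distrib Complex.DeMoivre)
  have cont: "continuous_on {0..2 * pi} g"
    unfolding g_def
    by (intro continuous_intros continuous_on_holomorphic_circle[OF hol r]) (use r in auto)
  have "(\<integral>t. Re (g t) * cos (real n * t + \<alpha>) \<partial>angle_measure)
      = Re (cis (- \<alpha>) * ((1 / r ^ n) * (2 * pi * r ^ (2 * n) * fps_nth (fps_expansion N 0) (2 * n)))) / 2"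
  proof (rule integral_Re_times_cos[OF cont])
    show "((\<lambda>t. g t * cis (- (real n * t))) has_integral
       (1 / r ^ n) * (2 * pi * r ^ (2 * n) * fps_nth (fps_expansion N 0) (2 * n))) {0..2 * pi}"
      unfolding g1 by (intro has_integral_mult_right circle_fourier_coeff[OF hol r])
    have "((\<lambda>t. g t * cis (real n * t)) has_integral
       (1 / r ^ n) * (2 * pi * r ^ 0 * fps_nth (fps_expansion N 0) 0)) {0..2 * pi}"
      unfolding g2 by (intro has_integral_mult_right circle_fourier_coeff[OF hol r])
    then show "((\<lambda>t. g t * cis (real n * t)) has_integral 0) {0..2 * pi}"
      by (simp add: fps_expansion_def N0)
  qed
  also have "(1 / r ^ n) * (2 * pi * r ^ (2 * n) * fps_nth (fps_expansion N 0) (2 * n))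
      = of_real (2 * pi * r ^ n) * fps_nth (fps_expansion N 0) (2 * n)"
  proof -
    have "(1 / r ^ n) * (2 * pi * r ^ (2 * n)) = 2 * pi * r ^ n"
      unfolding mult_2 power_add using r by simp
    then show ?thesis
      by (simp only: mult.assoc[symmetric] of_real_mult[symmetric])
  qed
  also have "Re (cis (- \<alpha>) * \<dots>) / 2 = pi * r ^ n * Re (cis (- \<alpha>) * fps_nth (fps_expansion N 0) (2 * n))"
    by (simp add: algebra_simps)
  finally show ?thesis by (simp add: g_def)
qed

lemma fps_nth_Ln_one_minus:
  assumes "n \<ge> 1"
  shows "fps_nth (fps_expansion (\<lambda>w. Ln (1 - b * w)) 0) n = - (b ^ n) / of_nat n"
proof -
  define F where "F = Abs_fps (\<lambda>n. - (b ^ n) / of_nat n)"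
  have "(\<lambda>w. Ln (1 - b * w)) has_fps_expansion F"
  proof (rule has_fps_expansionI)
    have "eventually (\<lambda>w. w \<in> {w. cmod (b * w) < 1}) (nhds 0)"
      by (intro eventually_nhds_in_open open_Collect_less continuous_intros) auto
    then show "eventually (\<lambda>w. (\<lambda>n. fps_nth F n * w ^ n) sums Ln (1 - b * w)) (nhds 0)"
    proof eventually_elim
      case (elim w)
      then show ?case
        using Ln_series'[of "- (b * w)"] by (simp add: F_def power_mult_distrib)
    qed
  qed
  from fps_nth_fps_expansion[OF this, of n] show ?thesis
    by (simp add: F_def fps_expansion_def)
qed

text \<open>
  Convolution with the kernel \<open>log \<bar>1 - x e\<^sup>i\<^sup>t\<bar>\<^sup>2\<close> multiplies \<open>cos (n t + \<alpha>)\<close> by a scalar: the Taylor series of the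
  logarithm is the Fourier expansion of the kernel.
\<close>

lemma integral_log_circle_kernel:
  assumes x: "0 < x" "x < 1" and n: "n \<ge> 1"
  shows "(\<integral>t. ln ((cmod (1 - of_real x * cis (t - s)))\<^sup>2) * cos (real n * t + \<alpha>) \<partial>angle_measure)
      = - (2 * pi * x ^ n / real n) * cos (real n * s + \<alpha>)"
proof -
  define b where "b = of_real x * cis (- s)"
  have b: "cmod b = x" using x by (simp add: b_def norm_mult)
  have hol: "(\<lambda>w. Ln (1 - b * w)) holomorphic_on ball 0 (1 / x)"
  proof (intro holomorphic_intros)
    fix w :: complex assume "w \<in> ball 0 (1 / x)"
    then have "cmod (b * w) < 1" using x by (simp add: norm_mult b field_simps)
    then have "Re (b * w) < 1" using complex_Re_le_cmod[of "b * w"] by linarith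
    then show "1 - b * w \<notin> \<real>\<^sub>\<le>\<^sub>0" by (auto simp: complex_nonpos_Reals_iff)
  qed
  have ln_eq: "ln ((cmod (1 - of_real x * cis (t - s)))\<^sup>2) = 2 * Re (Ln (1 - b * (of_real 1 * cis t)))" for t
  proof -
    have eq: "b * (of_real 1 * cis t) = of_real x * cis (t - s)"
      by (simp add: b_def cis_mult)
    have "cmod (of_real x * cis (t - s)) < 1" using x by (simp add: norm_mult)
    then have "1 - of_real x * cis (t - s) \<noteq> 0" by auto
    then show ?thesis unfolding eq by (simp add: ln_realpow)
  qed
  have "(\<integral>t. ln ((cmod (1 - of_real x * cis (t - s)))\<^sup>2) * cos (real n * t + \<alpha>) \<partial>angle_measure)
      = 2 * (\<integral>t. Re (Ln (1 - b * (of_real 1 * cis t))) * cos (real n * t + \<alpha>) \<partial>angle_measure)"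
    unfolding ln_eq by (simp add: mult.assoc)
  also have "\<dots> = 2 * (pi * Re (cis (- \<alpha>) * (- (b ^ n) / of_nat n)))"
    using x by (subst integral_Re_holomorphic_times_cos[OF hol _ _ n])
      (auto simp: fps_nth_Ln_one_minus[OF n])
  also have "cis (- \<alpha>) * (- (b ^ n) / of_nat n) = of_real (- (x ^ n / real n)) * cis (- (real n * s + \<alpha>))"
    by (simp add: b_def power_mult_distrib Complex.DeMoivre cis_mult algebra_simps)
  also have "Re \<dots> = - (x ^ n / real n) * cos (real n * s + \<alpha>)"
    by (simp only: times_complex.sel complex_of_real_def complex.sel cis.sel cos_minus)
  finally show ?thesis
    by (simp add: algebra_simps)
qed

text \<open>
  Both are Fourier integrals of monomials on the unit circle.
\<close>

lemma integral_angle_cos: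
  assumes n: "n \<ge> 1"
  shows "(\<integral>t. cos (real n * t + \<alpha>) * cos (real n * t + \<alpha>) \<partial>angle_measure) = pi"
    and "(\<integral>t. cos (real n * t + \<alpha>) \<partial>angle_measure) = 0"
proof -
  have hol: "(\<lambda>z. cis \<alpha> * z ^ n) holomorphic_on ball 0 2" by (intro holomorphic_intros)
  have "(\<lambda>z. cis \<alpha> * z ^ n) has_fps_expansion fps_const (cis \<alpha>) * fps_X ^ n"
    by (intro fps_expansion_intros)
  from fps_nth_fps_expansion[OF this, of n]
  have nth: "fps_nth (fps_expansion (\<lambda>z. cis \<alpha> * z ^ n) 0) n = cis \<alpha>"
    by (simp add: fps_expansion_def)
  have Re_eq: "Re (cis \<alpha> * (of_real 1 * cis t) ^ n) = cos (real n * t + \<alpha>)" for t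
  proof -
    have "cis \<alpha> * (of_real 1 * cis t) ^ n = cis (real n * t + \<alpha>)"
      by (simp add: Complex.DeMoivre cis_mult add.commute)
    then show ?thesis by (simp only: cis.sel)
  qed
  show "(\<integral>t. cos (real n * t + \<alpha>) * cos (real n * t + \<alpha>) \<partial>angle_measure) = pi"
    using integral_Re_holomorphic_times_cos[OF hol, of 1 n \<alpha>] n unfolding Re_eq nth
    by (simp add: cis_mult)
  have hol1: "(\<lambda>z. 1) holomorphic_on ball 0 2" by (intro holomorphic_intros)
  show "(\<integral>t. cos (real n * t + \<alpha>) \<partial>angle_measure) = 0"
    using integral_Re_holomorphic_times_cos[OF hol1, of 1 n \<alpha>] n
    by (simp add: fps_expansion_def)
qed

section \<open>The difference quotient of an injective holomorphic function\<close>

lemma difference_quotient_holomorphic: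
  assumes hol: "F holomorphic_on ball 0 1" and inj: "inj_on F (ball 0 1)" and z: "z \<in> ball 0 (1::real)"
  defines "K \<equiv> \<lambda>w. if w = z then deriv F z else (F w - F z) / (w - z)"
  shows "K holomorphic_on ball 0 1" and "\<And>w. w \<in> ball 0 1 \<Longrightarrow> K w \<noteq> 0"
proof -
  show "K holomorphic_on ball 0 1"
    unfolding K_def by (rule pole_lemma_open[OF hol open_ball])
  fix w :: complex assume w: "w \<in> ball 0 1"
  have "deriv F z \<noteq> 0"
    by (rule holomorphic_injective_imp_regular[OF hol open_ball inj z])
  moreover have "F w \<noteq> F z" if "w \<noteq> z"
    using inj w z that by (auto dest: inj_onD)
  ultimately show "K w \<noteq> 0"
    by (auto simp: K_def)
qed

lemma difference_quotient_log:
  assumes "F holomorphic_on ball 0 1" "inj_on F (ball 0 1)" "z \<in> ball 0 (1::real)"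
  obtains H where "H holomorphic_on ball 0 1"
    "\<And>w. w \<in> ball 0 1 \<Longrightarrow> exp (H w) * (w - z) = F w - F z"
proof -
  note K = difference_quotient_holomorphic[OF assms]
  obtain H where H: "H holomorphic_on ball 0 1"
    "\<And>w. w \<in> ball 0 1 \<Longrightarrow> exp (H w) = (if w = z then deriv F z else (F w - F z) / (w - z))"
    using holomorphic_logarithm_exists[OF convex_ball open_ball K(1) K(2), of 0] by auto
  show ?thesis
    by (rule that[OF H(1)]) (use H(2) in auto)
qed

text \<open>
  For fixed \<open>z\<close> the difference quotient is holomorphic in \<open>w\<close> without zeros, so the maximum principle for it and for
  its reciprocal reduces the estimate to \<open>w\<close> on a larger circle of radius \<open>R\<close>, where \<open>\<bar>w - z\<bar>\<close> stays away from \<open>0\<close>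
  and compactness applies.
\<close>

lemma difference_quotient_bounds:
  assumes hol: "F holomorphic_on ball 0 1" and inj: "inj_on F (ball 0 1)" and r: "0 < r" "r < 1"
  obtains m M where "0 < m"
    "\<And>z w. cmod z \<le> r \<Longrightarrow> cmod w \<le> r \<Longrightarrow> m * cmod (w - z) \<le> cmod (F w - F z)"
    "\<And>z w. cmod z \<le> r \<Longrightarrow> cmod w \<le> r \<Longrightarrow> cmod (F w - F z) \<le> M * cmod (w - z)"
proof -
  define R where "R = (1 + r) / 2"
  have R: "r < R" "R < 1" "0 < R" using r by (auto simp: R_def)
  define T where "T = cball (0::complex) r \<times> sphere (0::complex) R"
  define G where "G = (\<lambda>p. cmod (F (snd p) - F (fst p)))"
  have "compact T" unfolding T_def by (intro compact_Times compact_cball compact_sphere)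
  moreover have "T \<noteq> {}" using r R by (auto simp: T_def)
  moreover have "continuous_on T G"
    unfolding G_def
    by (intro continuous_intros continuous_on_compose2[OF holomorphic_on_imp_continuous_on[OF hol]])
       (use r R in \<open>auto simp: T_def\<close>)
  ultimately obtain p q where p: "p \<in> T" "\<And>v. v \<in> T \<Longrightarrow> G p \<le> G v"
      and q: "q \<in> T" "\<And>v. v \<in> T \<Longrightarrow> G v \<le> G q"
    using continuous_attains_inf[of T G] continuous_attains_sup[of T G] by metis
  have Gp: "G p > 0"
  proof -
    have "fst p \<noteq> snd p" "fst p \<in> ball 0 1" "snd p \<in> ball 0 1"
      using p(1) r R by (auto simp: T_def)
    then have "F (snd p) \<noteq> F (fst p)" using inj by (auto dest: inj_onD)
    then show ?thesis by (simp add: G_def)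
  qed
  have fr: "closure (cball (0::complex) R) = cball 0 R" "frontier (cball (0::complex) R) = sphere 0 R"
    "interior (cball (0::complex) R) = ball 0 R"
    by auto
  have bound: "G p / (R + r) \<le> cmod ((F w - F z) / (w - z)) \<and> cmod ((F w - F z) / (w - z)) \<le> G q / (R - r)"
    if z: "cmod z \<le> r" and w: "cmod w \<le> r" and zw: "w \<noteq> z" for z w
  proof -
    define K where "K = (\<lambda>w. if w = z then deriv F z else (F w - F z) / (w - z))"
    have zb: "z \<in> ball 0 1" using z r by auto
    have K: "K holomorphic_on ball 0 1" "\<And>v. v \<in> ball 0 1 \<Longrightarrow> K v \<noteq> 0"
      unfolding K_def by (fact difference_quotient_holomorphic[OF hol inj zb])+
    have edge: "cmod (K v) \<le> G q / (R - r)" "cmod (1 / K v) \<le> (R + r) / G p" if v: "v \<in> sphere 0 R" for v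
    proof -
      have zv: "(z, v) \<in> T" using z v by (auto simp: T_def)
      have Kv: "cmod (K v) = G (z, v) / cmod (v - z)"
        using z v R by (auto simp: K_def G_def norm_divide)
      have d: "R - r \<le> cmod (v - z)" "cmod (v - z) \<le> R + r"
        using norm_triangle_ineq2[of v z] norm_triangle_ineq4[of v z] z v by auto
      show "cmod (K v) \<le> G q / (R - r)"
        unfolding Kv using q(2)[OF zv] d R Gp p(2)[OF zv] by (intro frac_le) auto
      have "cmod (1 / K v) = cmod (v - z) / G (z, v)"
        using Kv by (simp add: norm_divide)
      also have "\<dots> \<le> (R + r) / G p"
        using p(2)[OF zv] d R Gp by (intro frac_le) auto
      finally show "cmod (1 / K v) \<le> (R + r) / G p" .
    qed
    have sub: "ball 0 R \<subseteq> ball (0::complex) 1" "cball 0 R \<subseteq> ball (0::complex) 1" using R by auto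
    have 1: "cmod (K w) \<le> G q / (R - r)"
      by (rule maximum_modulus_frontier[of K "cball 0 R"], unfold fr)
         (use w R edge K sub in \<open>auto intro: holomorphic_on_subset holomorphic_on_imp_continuous_on\<close>)
    have inv: "(\<lambda>v. 1 / K v) holomorphic_on ball 0 1"
      by (rule holomorphic_on_divide[OF holomorphic_on_const K])
    have 2: "cmod (1 / K w) \<le> (R + r) / G p"
      by (rule maximum_modulus_frontier[of "\<lambda>v. 1 / K v" "cball 0 R"], unfold fr)
         (use w R edge inv sub in \<open>auto intro: holomorphic_on_subset holomorphic_on_imp_continuous_on\<close>)
    have "cmod (K w) > 0" using K(2)[of w] w r by auto
    with 2 have "G p / (R + r) \<le> cmod (K w)"
      using Gp R r by (simp add: norm_divide field_simps)
    with 1 zw show ?thesis by (simp add: K_def)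
  qed
  show ?thesis
  proof (rule that)
    show "0 < G p / (R + r)" using Gp R r by simp
    fix z w :: complex assume zw: "cmod z \<le> r" "cmod w \<le> r"
    show "G p / (R + r) * cmod (w - z) \<le> cmod (F w - F z)"
      using bound[OF zw] by (cases "w = z") (auto simp: norm_divide pos_le_divide_eq)
    show "cmod (F w - F z) \<le> G q / (R - r) * cmod (w - z)"
      using bound[OF zw] by (cases "w = z") (auto simp: norm_divide pos_divide_le_eq)
  qed
qed

section \<open>The diagonal Grunsky inequality\<close>

lemma AE_cis_neq: "AE t in angle_measure. cis t \<noteq> cis s"
proof -
  have "{t. cis t = cis s} \<subseteq> range (\<lambda>k::int. s + of_int k * (2 * pi))"
  proof
    fix t assume "t \<in> {t. cis t = cis s}"
    then have "cis (t - s) = 1"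
      by (simp add: cis_divide[symmetric])
    then have "cos (t - s) = 1" by (simp add: complex_eq_iff)
    then obtain k :: int where "t - s = of_int k * 2 * pi"
      by (auto simp: cos_one_2pi_int)
    then have "t = s + of_int k * (2 * pi)" by simp
    then show "t \<in> range (\<lambda>k::int. s + of_int k * (2 * pi))" by blast
  qed
  then have "countable {t. cis t = cis s}"
    by (rule countable_subset) auto
  from AE_not_in[OF countable_imp_null_set_lborel[OF this]]
  show ?thesis
    unfolding angle_measure_def by (subst AE_restrict_space_iff) auto
qed

lemma abs_ln_le:
  fixes q :: real
  assumes "0 < l" "l \<le> q" "q \<le> u"
  shows "\<bar>ln q\<bar> \<le> \<bar>ln l\<bar> + \<bar>ln u\<bar>"
proof -
  have "ln l \<le> ln q" "ln q \<le> ln u" using assms by auto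
  then show ?thesis by linarith
qed

lemma norm_one_minus_scaled_cis:
  "(cmod (1 - of_real x * cis \<theta>))\<^sup>2 = (1 - x)\<^sup>2 + x * (cmod (1 - cis \<theta>))\<^sup>2"
proof -
  have "x\<^sup>2 * (cos \<theta>)\<^sup>2 + x\<^sup>2 * (sin \<theta>)\<^sup>2 = x\<^sup>2"
    by (simp flip: distrib_left)
  moreover have "x * (cos \<theta>)\<^sup>2 + x * (sin \<theta>)\<^sup>2 = x"
    by (simp flip: distrib_left)
  ultimately show ?thesis
    unfolding cmod_power2 by (simp add: power_mult_distrib power2_diff algebra_simps)
qed

text \<open>
  The energy inequality for the unsmoothed kernel, measured relative to the circle. Both \<open>log \<bar>w(s) - w(t)\<bar>\<^sup>2\<close> and
  \<open>log \<bar>e\<^sup>i\<^sup>t - e\<^sup>i\<^sup>s\<bar>\<^sup>2\<close> are singular on the diagonal. Smoothing the first to \<open>log (\<epsilon> + \<bar>w(s) - w(t)\<bar>\<^sup>2)\<close> and the second to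
  \<open>log \<bar>1 - x e\<^sup>i\<^sup>(\<^sup>t\<^sup>-\<^sup>s\<^sup>)\<bar>\<^sup>2\<close> with \<open>\<epsilon> = (1 - x)\<^sup>2\<close> keeps their difference bounded as \<open>x\<close> tends to \<open>1\<close>, because the chord lengths
  of the curve and of the circle are comparable; so the limit is a matter of dominated convergence. For each \<open>x\<close>
  the first kernel has nonpositive energy and the energy of the second is computed exactly.
\<close>

lemma log_energy_of_curve_le:
  fixes w :: "real \<Rightarrow> complex" and \<alpha> :: real
  assumes w_meas: "w \<in> borel_measurable borel"
    and w_bounded: "\<And>t. cmod (w t) \<le> W"
    and ab: "0 < a" "\<And>s t. a * (cmod (cis t - cis s))\<^sup>2 \<le> (cmod (w s - w t))\<^sup>2"
      "\<And>s t. (cmod (w s - w t))\<^sup>2 \<le> b * (cmod (cis t - cis s))\<^sup>2"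
    and n: "n \<ge> 1"
  defines "L \<equiv> \<lambda>s t. ln ((cmod (w s - w t))\<^sup>2) - ln ((cmod (cis t - cis s))\<^sup>2)"
  defines "\<phi> \<equiv> \<lambda>t. cos (real n * t + \<alpha>)"
  shows "integrable (angle_measure \<Otimes>\<^sub>M angle_measure) (\<lambda>p. L (fst p) (snd p) * (\<phi> (fst p) * \<phi> (snd p)))"
    and "(\<integral>p. L (fst p) (snd p) * (\<phi> (fst p) * \<phi> (snd p)) \<partial>(angle_measure \<Otimes>\<^sub>M angle_measure))
      \<le> 2 * pi\<^sup>2 / real n"
proof -
  let ?M = angle_measure
  let ?P = "?M \<Otimes>\<^sub>M ?M"
  interpret finite_measure ?M by (rule finite_measure_angle_measure)
  interpret PM: pair_sigma_finite ?M ?M by unfold_locales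
  note meas = borel_measurable_angle_measure
  have [measurable]: "w \<in> borel_measurable ?M" by (rule meas) (rule w_meas)
  have [measurable]: "\<phi> \<in> borel_measurable ?M"
    unfolding \<phi>_def by (intro meas borel_measurable_continuous_onI continuous_intros)
  have [measurable]: "cis \<in> borel_measurable ?M"
    by (intro meas borel_measurable_continuous_onI continuous_intros)
  have \<phi>b: "\<bar>\<phi> t\<bar> \<le> 1" for t by (simp add: \<phi>_def)
  have \<psi>b: "\<bar>\<phi> s * \<phi> t\<bar> \<le> 1" for s t using abs_mult_le[OF \<phi>b[of s] \<phi>b[of t]] by simp
  define \<theta> where "\<theta> s t = (cmod (cis t - cis s))\<^sup>2" for s t
  define \<delta> where "\<delta> s t = (cmod (w s - w t))\<^sup>2" for s t
  have \<theta>0: "\<theta> s t \<ge> 0" for s t by (simp add: \<theta>_def)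
  have \<theta>4: "\<theta> s t \<le> 4" for s t
  proof -
    have "cmod (cis t - cis s) \<le> 2" using norm_triangle_ineq4[of "cis t" "cis s"] by simp
    from power_mono[OF this, of 2] show ?thesis by (simp add: \<theta>_def)
  qed
  have \<delta>: "a * \<theta> s t \<le> \<delta> s t" "\<delta> s t \<le> b * \<theta> s t" for s t
    using ab(2)[of t s] ab(3)[of s t] by (simp_all add: \<theta>_def \<delta>_def)
  define x where "x j = 1 - 1 / real (j + 2)" for j
  have x: "1 / 2 \<le> x j" "x j < 1" for j by (auto simp: x_def field_simps)
  have x_lim: "x \<longlonglongrightarrow> 1"
  proof -
    have "(\<lambda>j. 1 - 1 / real (j + 2)) \<longlonglongrightarrow> 1 - 0"
      by (intro tendsto_diff tendsto_const) (rule LIMSEQ_ignore_initial_segment[OF lim_1_over_n])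
    then show ?thesis by (simp add: x_def[abs_def])
  qed
  define \<epsilon> where "\<epsilon> j = (1 - x j)\<^sup>2" for j
  have \<epsilon>: "0 < \<epsilon> j" for j using x(2)[of j] by (simp add: \<epsilon>_def)
  define e where "e j s t = \<epsilon> j + x j * \<theta> s t" for j s t
  define q where "q j s t = \<epsilon> j + \<delta> s t" for j s t
  \<comment> \<open>this identity is the reason for the choice \<open>\<epsilon> = (1 - x)\<^sup>2\<close>\<close>
  have e_eq: "e j s t = (cmod (1 - of_real (x j) * cis (t - s)))\<^sup>2" for j s t
  proof -
    have "cis t - cis s = - cis s * (1 - cis (t - s))"
      by (simp add: right_diff_distrib cis_mult)
    then have "cmod (cis t - cis s) = cmod (1 - cis (t - s))"
      by (simp add: norm_mult)
    then show ?thesis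
      unfolding norm_one_minus_scaled_cis by (simp add: e_def \<epsilon>_def \<theta>_def)
  qed
  have [measurable]: "(\<lambda>p. e j (fst p) (snd p)) \<in> borel_measurable ?P" for j
    unfolding e_def \<theta>_def by measurable
  have [measurable]: "(\<lambda>p. q j (fst p) (snd p)) \<in> borel_measurable ?P" for j
    unfolding q_def \<delta>_def by measurable
  have L_eq: "L s t = ln (\<delta> s t) - ln (\<theta> s t)" for s t
    by (simp add: L_def \<delta>_def \<theta>_def)
  have [measurable]: "(\<lambda>p. L (fst p) (snd p)) \<in> borel_measurable ?P"
    unfolding L_def by measurable
  define lo where "lo = min 1 a"
  \<comment> \<open>the factor \<open>2\<close> is needed because \<open>x j\<close> can be as small as \<open>1/2\<close>\<close>
  define hi where "hi = 2 * max 1 b"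
  have lo: "0 < lo" "lo \<le> 1" "lo \<le> a" and hi: "1 \<le> hi" "b \<le> hi / 2" "2 \<le> hi"
    using ab(1) by (auto simp: lo_def hi_def)
  have e_pos: "0 < e j s t" for j s t
    using \<epsilon>[of j] x(1)[of j] \<theta>0[of s t] unfolding e_def by (intro add_pos_nonneg mult_nonneg_nonneg) auto
  have ratio: "lo \<le> q j s t / e j s t" "q j s t / e j s t \<le> hi" for j s t
  proof -
    have "lo * e j s t = lo * \<epsilon> j + lo * (x j * \<theta> s t)"
      by (simp add: e_def algebra_simps)
    also have "\<dots> \<le> 1 * \<epsilon> j + a * (1 * \<theta> s t)"
      using lo x[of j] \<theta>0[of s t] less_imp_le[OF \<epsilon>[of j]]
      by (intro add_mono mult_mono mult_nonneg_nonneg) auto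
    also have "\<dots> \<le> q j s t" using \<delta>(1)[of s t] by (simp add: q_def)
    finally show "lo \<le> q j s t / e j s t"
      using e_pos[of j s t] by (simp add: pos_le_divide_eq)
    have "q j s t \<le> 1 * \<epsilon> j + (hi / 2) * \<theta> s t"
      using \<delta>(2)[of s t] mult_right_mono[OF hi(2) \<theta>0[of s t]] by (simp add: q_def)
    also have "\<dots> \<le> hi * \<epsilon> j + (hi * x j) * \<theta> s t"
    proof (intro add_mono mult_right_mono \<theta>0)
      show "hi / 2 \<le> hi * x j"
        using mult_left_mono[OF x(1)[of j], of hi] hi by simp
    qed (use hi \<epsilon>[of j] in auto)
    also have "\<dots> = hi * e j s t" by (simp add: e_def algebra_simps)
    finally show "q j s t / e j s t \<le> hi"
      using e_pos[of j s t] by (simp add: pos_divide_le_eq)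
  qed
  have q_pos: "0 < q j s t" for j s t
  proof -
    have "0 < q j s t / e j s t" using ratio(1)[of j s t] lo(1) by linarith
    then show ?thesis using e_pos[of j s t] by (simp add: zero_less_divide_iff)
  qed
  define B where "B = \<bar>ln lo\<bar> + \<bar>ln hi\<bar>"
  have diff_b: "\<bar>ln (q j s t) - ln (e j s t)\<bar> \<le> B" for j s t
  proof -
    have "ln (q j s t) - ln (e j s t) = ln (q j s t / e j s t)"
      using q_pos[of j s t] e_pos[of j s t] by (simp add: ln_div)
    then show ?thesis
      unfolding B_def using abs_ln_le[OF lo(1) ratio] by simp
  qed
  have L_b: "\<bar>L s t\<bar> \<le> B" for s t
  \<comment> \<open>on the diagonal the value of \<open>L\<close> is \<open>0\<close>, since \<open>ln 0 = 0\<close>\<close>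
  proof (cases "\<theta> s t = 0")
    case True
    then have "\<delta> s t = 0" using \<delta>[of s t] by simp
    then show ?thesis using True by (simp add: L_eq B_def)
  next
    case False
    then have pos: "\<theta> s t > 0" using \<theta>0[of s t] by simp
    have low: "lo \<le> \<delta> s t / \<theta> s t"
      unfolding pos_le_divide_eq[OF pos] by (rule order_trans[OF mult_right_mono[OF lo(3) \<theta>0] \<delta>(1)])
    have "b \<le> hi" using hi by linarith
    have upp: "\<delta> s t / \<theta> s t \<le> hi"
      unfolding pos_divide_le_eq[OF pos] by (rule order_trans[OF \<delta>(2) mult_right_mono[OF \<open>b \<le> hi\<close> \<theta>0]])
    have "0 < \<delta> s t / \<theta> s t" using low lo(1) by linarith
    then have "\<delta> s t > 0" using pos by (simp add: zero_less_divide_iff)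
    then have "L s t = ln (\<delta> s t / \<theta> s t)" using pos by (simp add: L_eq ln_div)
    then show ?thesis unfolding B_def using abs_ln_le[OF lo(1) low upp] by simp
  qed
  show int_L: "integrable ?P (\<lambda>p. L (fst p) (snd p) * (\<phi> (fst p) * \<phi> (snd p)))"
  proof (rule integrable_pair_bounded)
    show "\<bar>L (fst (s, t)) (snd (s, t)) * (\<phi> (fst (s, t)) * \<phi> (snd (s, t)))\<bar> \<le> B * 1" for s t
      unfolding fst_conv snd_conv by (intro abs_mult_le L_b \<psi>b)
  qed measurable
  have int_e: "integrable ?P (\<lambda>p. ln (e j (fst p) (snd p)) * (\<phi> (fst p) * \<phi> (snd p)))" for j
  proof (rule integrable_pair_bounded)
    fix s t
    have "x j * \<theta> s t \<le> 1 * 4" using x[of j] \<theta>4 \<theta>0 by (intro mult_mono) auto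
    moreover have "0 \<le> x j * \<theta> s t" using x[of j] \<theta>0[of s t] by simp
    ultimately have "\<bar>ln (e j s t)\<bar> \<le> \<bar>ln (\<epsilon> j)\<bar> + \<bar>ln (\<epsilon> j + 4)\<bar>"
      using \<epsilon>[of j] by (intro abs_ln_le) (auto simp: e_def)
    then show "\<bar>ln (e j (fst (s, t)) (snd (s, t))) * (\<phi> (fst (s, t)) * \<phi> (snd (s, t)))\<bar>
        \<le> (\<bar>ln (\<epsilon> j)\<bar> + \<bar>ln (\<epsilon> j + 4)\<bar>) * 1"
      unfolding fst_conv snd_conv by (intro abs_mult_le \<psi>b)
  qed measurable
  have int_q: "integrable ?P (\<lambda>p. ln (q j (fst p) (snd p)) * (\<phi> (fst p) * \<phi> (snd p)))" for j
  proof (rule integrable_pair_bounded)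
    fix s t
    have "\<delta> s t \<le> (W + W)\<^sup>2"
      unfolding \<delta>_def using norm_triangle_ineq4[of "w s" "w t"] w_bounded[of s] w_bounded[of t]
      by (intro power_mono) auto
    moreover have "0 \<le> \<delta> s t" by (simp add: \<delta>_def)
    ultimately have "\<bar>ln (q j s t)\<bar> \<le> \<bar>ln (\<epsilon> j)\<bar> + \<bar>ln (\<epsilon> j + (W + W)\<^sup>2)\<bar>"
      using \<epsilon>[of j] by (intro abs_ln_le) (auto simp: q_def)
    then show "\<bar>ln (q j (fst (s, t)) (snd (s, t))) * (\<phi> (fst (s, t)) * \<phi> (snd (s, t)))\<bar>
        \<le> (\<bar>ln (\<epsilon> j)\<bar> + \<bar>ln (\<epsilon> j + (W + W)\<^sup>2)\<bar>) * 1"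
      unfolding fst_conv snd_conv by (intro abs_mult_le \<psi>b)
  qed measurable
  have energy_e: "(\<integral>p. ln (e j (fst p) (snd p)) * (\<phi> (fst p) * \<phi> (snd p)) \<partial>?P) = - (2 * pi\<^sup>2 * x j ^ n / real n)" for j
  proof -
    have "(\<integral>p. ln (e j (fst p) (snd p)) * (\<phi> (fst p) * \<phi> (snd p)) \<partial>?P)
        = (\<integral>s. (\<integral>t. ln (e j s t) * (\<phi> s * \<phi> t) \<partial>?M) \<partial>?M)"
      using PM.integral_fst'[OF int_e[of j]] by simp
    also have "\<dots> = (\<integral>s. \<phi> s * (\<integral>t. ln (e j s t) * \<phi> t \<partial>?M) \<partial>?M)"
      by (simp add: mult_ac flip: integral_mult_right_zero)
    also have "\<dots> = (\<integral>s. - (2 * pi * x j ^ n / real n) * (\<phi> s * \<phi> s) \<partial>?M)"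
      unfolding e_eq \<phi>_def using x[of j]
      by (subst integral_log_circle_kernel[OF _ _ n]) (auto simp: mult_ac)
    also have "\<dots> = - (2 * pi * x j ^ n / real n) * pi"
      unfolding integral_mult_right_zero \<phi>_def integral_angle_cos(1)[OF n] ..
    finally show ?thesis by (simp add: power2_eq_square)
  qed
  have energy_q: "(\<integral>p. ln (q j (fst p) (snd p)) * (\<phi> (fst p) * \<phi> (snd p)) \<partial>?P) \<le> 0" for j
    unfolding q_def \<delta>_def
  proof (rule neutral_log_energy_nonpos[where W = W and C = 1])
    show "(\<integral>t. \<phi> t \<partial>?M) = 0"
      unfolding \<phi>_def by (rule integral_angle_cos(2)[OF n])
  qed (use w_bounded \<phi>b \<epsilon> in auto)
  define T where "T j p = (ln (q j (fst p) (snd p)) - ln (e j (fst p) (snd p))) * (\<phi> (fst p) * \<phi> (snd p))" for j p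
  have T_le: "integral\<^sup>L ?P (T j) \<le> 2 * pi\<^sup>2 / real n" for j
  proof -
    have "integral\<^sup>L ?P (T j) = (\<integral>p. ln (q j (fst p) (snd p)) * (\<phi> (fst p) * \<phi> (snd p)) \<partial>?P)
        - (\<integral>p. ln (e j (fst p) (snd p)) * (\<phi> (fst p) * \<phi> (snd p)) \<partial>?P)"
      unfolding T_def left_diff_distrib by (rule Bochner_Integration.integral_diff[OF int_q int_e])
    also have "\<dots> \<le> 2 * pi\<^sup>2 * x j ^ n / real n"
      using energy_q[of j] energy_e[of j] by simp
    also have "\<dots> \<le> 2 * pi\<^sup>2 * 1 / real n"
      using x[of j] by (intro divide_right_mono mult_left_mono power_le_one) auto
    finally show ?thesis by simp
  qed
  interpret P: finite_measure ?P
    by (intro finite_measure_pair_measure finite_measure_axioms)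
  have "(\<lambda>j. integral\<^sup>L ?P (T j)) \<longlonglongrightarrow> (\<integral>p. L (fst p) (snd p) * (\<phi> (fst p) * \<phi> (snd p)) \<partial>?P)"
  proof (rule integral_dominated_convergence[where w = "\<lambda>_. B * 1"])
    have "AE p in ?P. \<theta> (fst p) (snd p) \<noteq> 0"
    proof (rule PM.AE_pair_measure)
      show "{p \<in> space ?P. \<theta> (fst p) (snd p) \<noteq> 0} \<in> sets ?P"
        unfolding \<theta>_def by measurable
      show "AE s in ?M. AE t in ?M. \<theta> (fst (s, t)) (snd (s, t)) \<noteq> 0"
        using AE_cis_neq by (auto simp: \<theta>_def)
    qed
    then show "AE p in ?P. (\<lambda>j. T j p) \<longlonglongrightarrow> L (fst p) (snd p) * (\<phi> (fst p) * \<phi> (snd p))"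
    proof eventually_elim
      case (elim p)
      obtain s t where p: "p = (s, t)" by (cases p)
      have th: "\<theta> s t > 0" using elim \<theta>0[of s t] by (simp add: p)
      have de: "\<delta> s t > 0" using \<delta>(1)[of s t] ab(1) th mult_pos_pos[of a "\<theta> s t"] by linarith
      have \<epsilon>_lim: "\<epsilon> \<longlonglongrightarrow> 0"
        unfolding \<epsilon>_def[abs_def] using tendsto_power[OF tendsto_diff[OF tendsto_const x_lim], of 1 2] by simp
      have "(\<lambda>j. q j s t) \<longlonglongrightarrow> 0 + \<delta> s t"
        unfolding q_def by (intro tendsto_intros \<epsilon>_lim)
      moreover have "(\<lambda>j. e j s t) \<longlonglongrightarrow> 0 + 1 * \<theta> s t"
        unfolding e_def by (intro tendsto_intros \<epsilon>_lim x_lim)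
      ultimately have "(\<lambda>j. (ln (q j s t) - ln (e j s t)) * (\<phi> s * \<phi> t)) \<longlonglongrightarrow>
          (ln (0 + \<delta> s t) - ln (0 + 1 * \<theta> s t)) * (\<phi> s * \<phi> t)"
        using th de by (intro tendsto_intros) auto
      then show ?case by (simp add: T_def L_eq p)
    qed
    show "AE p in ?P. norm (T j p) \<le> B * 1" for j
      unfolding T_def real_norm_def by (intro AE_I2 abs_mult_le diff_b \<psi>b)
  qed (simp_all add: T_def[abs_def])
  then show "(\<integral>p. L (fst p) (snd p) * (\<phi> (fst p) * \<phi> (snd p)) \<partial>?P) \<le> 2 * pi\<^sup>2 / real n"
    by (rule LIMSEQ_le_const2) (use T_le in auto)
qed

lemma fps_nth_expansion_cmult:
  assumes "N holomorphic_on ball 0 R" "0 < R"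
  shows "fps_nth (fps_expansion (\<lambda>z. c * N z) 0) k = c * fps_nth (fps_expansion N 0) k"
proof -
  have "N has_fps_expansion fps_expansion N 0"
    using assms by (intro has_fps_expansion_fps_expansion[of "ball 0 R"]) auto
  then have "(\<lambda>z. c * N z) has_fps_expansion fps_const c * fps_expansion N 0"
    by (rule has_fps_expansion_cmult_left)
  from fps_nth_fps_expansion[OF this, of k] show ?thesis
    by (simp add: fps_expansion_def)
qed

text \<open>
  Apply the energy inequality to the curve \<open>F(r e\<^sup>i\<^sup>t)\<close>. Off the diagonal the relative kernel is \<open>2 log r + 2 Re H\<close>, where \<open>H\<close> is
  a logarithm of the difference quotient, and the two integrations extract first its Taylor coefficient in \<open>w\<close> and
  then the Taylor coefficient in \<open>z\<close> of the result.
\<close>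

lemma diagonal_grunsky_on_circle:
  assumes hol: "F holomorphic_on ball 0 1" and inj: "inj_on F (ball 0 1)"
    and N: "N holomorphic_on ball 0 1" "N 0 = 0" and n: "n \<ge> 1"
    and coeff: "\<And>z H. z \<in> ball 0 1 - {0} \<Longrightarrow> H holomorphic_on ball 0 1 \<Longrightarrow>
      (\<And>w. w \<in> ball 0 1 \<Longrightarrow> exp (H w) * (w - z) = F w - F z) \<Longrightarrow>
      fps_nth (fps_expansion H 0) n * z ^ n = N z"
    and r: "0 < r" "r < 1"
  shows "r ^ (2 * n) * Re (cis (- 2 * \<alpha>) * fps_nth (fps_expansion N 0) (2 * n)) \<le> 1 / real n"
proof -
  let ?M = angle_measure
  interpret finite_measure ?M by (rule finite_measure_angle_measure)
  interpret PM: pair_sigma_finite ?M ?M by unfold_locales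
  define zc where "zc t = of_real r * cis t" for t
  define w where "w t = F (zc t)" for t
  define \<phi> where "\<phi> t = cos (real n * t + \<alpha>)" for t
  define L where "L s t = ln ((cmod (w s - w t))\<^sup>2) - ln ((cmod (cis t - cis s))\<^sup>2)" for s t
  have zc: "cmod (zc t) = r" "zc t \<in> ball 0 1 - {0}" for t
    using r by (auto simp: zc_def norm_mult)
  have zc_diff: "cmod (zc s - zc t) = r * cmod (cis t - cis s)" for s t
    using r by (simp add: zc_def norm_mult norm_minus_commute flip: right_diff_distrib)
  obtain m K where mK: "0 < m"
    "\<And>z w. cmod z \<le> r \<Longrightarrow> cmod w \<le> r \<Longrightarrow> m * cmod (w - z) \<le> cmod (F w - F z)"
    "\<And>z w. cmod z \<le> r \<Longrightarrow> cmod w \<le> r \<Longrightarrow> cmod (F w - F z) \<le> K * cmod (w - z)"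
    using difference_quotient_bounds[OF hol inj r] by blast
  have w_cont: "continuous_on UNIV w"
    unfolding w_def zc_def by (rule continuous_on_holomorphic_circle[OF hol r])
  then have w_meas: "w \<in> borel_measurable borel" by (rule borel_measurable_continuous_onI)
  have w_b: "cmod (w t) \<le> cmod (F 0) + \<bar>K\<bar> * r" for t
  proof -
    have "cmod (w t - F 0) \<le> K * r" using mK(3)[of 0 "zc t"] zc(1)[of t] r by (simp add: w_def)
    also have "\<dots> \<le> \<bar>K\<bar> * r" using r by (intro mult_right_mono) auto
    finally show ?thesis using norm_triangle_ineq2[of "w t" "F 0"] by linarith
  qed
  have lower: "(m * r)\<^sup>2 * (cmod (cis t - cis s))\<^sup>2 \<le> (cmod (w s - w t))\<^sup>2" for s t
  proof -
    have "m * (r * cmod (cis t - cis s)) \<le> cmod (w s - w t)"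
      using mK(2)[of "zc t" "zc s"] zc(1) by (simp add: w_def zc_diff)
    from power_mono[OF this, of 2] show ?thesis
      using mK(1) r by (simp add: power_mult_distrib)
  qed
  have upper: "(cmod (w s - w t))\<^sup>2 \<le> (K * r)\<^sup>2 * (cmod (cis t - cis s))\<^sup>2" for s t
  proof -
    have "cmod (w s - w t) \<le> K * (r * cmod (cis t - cis s))"
      using mK(3)[of "zc t" "zc s"] zc(1) by (simp add: w_def zc_diff)
    from power_mono[OF this, of 2] show ?thesis
      by (simp add: power_mult_distrib)
  qed
  have mr: "0 < (m * r)\<^sup>2" using mK(1) r by simp
  note energy = log_energy_of_curve_le[OF w_meas w_b mr lower upper n, of \<alpha>,
      folded L_def \<phi>_def]
  define G where "G z = cis (- \<alpha>) * N z" for z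
  have G: "G holomorphic_on ball 0 1" "G 0 = 0"
    using N by (auto simp: G_def[abs_def] intro!: holomorphic_intros)
  have inner: "(\<integral>t. L s t * (\<phi> s * \<phi> t) \<partial>?M) = (2 * pi * r ^ n) * (Re (G (zc s) / zc s ^ n) * \<phi> s)" for s
  proof -
    obtain H where H: "H holomorphic_on ball 0 1"
        "\<And>v. v \<in> ball 0 1 \<Longrightarrow> exp (H v) * (v - zc s) = F v - F (zc s)"
      using difference_quotient_log[OF hol inj, of "zc s"] zc(2)[of s] by blast
    have hn: "fps_nth (fps_expansion H 0) n = N (zc s) / zc s ^ n"
      using coeff[OF zc(2) H] zc(2)[of s] by (simp add: field_simps)
    have "(\<integral>t. L s t * (\<phi> s * \<phi> t) \<partial>?M) = \<phi> s * (\<integral>t. L s t * \<phi> t \<partial>?M)"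
      by (simp add: mult_ac flip: integral_mult_right_zero)
    also have "(\<integral>t. L s t * \<phi> t \<partial>?M) = (\<integral>t. (2 * ln r) * \<phi> t + 2 * (Re (H (zc t)) * \<phi> t) \<partial>?M)"
    proof (rule integral_cong_AE)
      show "AE t in ?M. L s t * \<phi> t = (2 * ln r) * \<phi> t + 2 * (Re (H (zc t)) * \<phi> t)"
        using AE_cis_neq[of s]
      proof eventually_elim
        case (elim t)
        have "cmod (w s - w t) = cmod (exp (H (zc t)) * (zc t - zc s))"
          using H(2)[of "zc t"] zc(2)[of t] by (simp add: w_def norm_minus_commute)
        also have "\<dots> = exp (Re (H (zc t))) * (r * cmod (cis t - cis s))"
          using zc_diff[of t s] by (simp add: norm_mult norm_exp norm_minus_commute)
        finally have "L s t = 2 * ln r + 2 * Re (H (zc t))"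
          using r elim by (simp add: L_def ln_realpow ln_mult)
        then show ?case by (simp add: algebra_simps)
      qed
      have H_cont: "continuous_on UNIV (\<lambda>t. H (zc t))"
        unfolding zc_def by (rule continuous_on_holomorphic_circle[OF H(1) r])
      show "(\<lambda>t. (2 * ln r) * \<phi> t + 2 * (Re (H (zc t)) * \<phi> t)) \<in> borel_measurable ?M"
        unfolding \<phi>_def
        by (intro borel_measurable_angle_measure borel_measurable_continuous_onI continuous_intros H_cont)
      have [measurable]: "w \<in> borel_measurable borel" "\<phi> \<in> borel_measurable borel" "cis \<in> borel_measurable borel"
        by (simp_all add: w_meas \<phi>_def[abs_def] borel_measurable_continuous_onI continuous_intros)
      show "(\<lambda>t. L s t * \<phi> t) \<in> borel_measurable ?M"
        unfolding L_def by (rule borel_measurable_angle_measure) measurable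
    qed
    also have "\<dots> = (2 * ln r) * (\<integral>t. \<phi> t \<partial>?M) + 2 * (\<integral>t. Re (H (zc t)) * \<phi> t \<partial>?M)"
    proof -
      have int: "integrable ?M f" if "continuous_on {0..2*pi} f" for f :: "real \<Rightarrow> real"
        using borel_integrable_atLeastAtMost'[OF that]
        by (simp add: angle_measure_def integrable_restrict_space set_integrable_def)
      have H_cont: "continuous_on A (\<lambda>t. H (zc t))" for A
        unfolding zc_def by (rule continuous_on_holomorphic_circle[OF H(1) r])
      have "integrable ?M \<phi>" "integrable ?M (\<lambda>t. Re (H (zc t)) * \<phi> t)"
        unfolding \<phi>_def by (intro int continuous_intros H_cont)+
      then show ?thesis by simp
    qed
    also have "\<dots> = 2 * pi * r ^ n * Re (cis (- \<alpha>) * (N (zc s) / zc s ^ n))"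
      unfolding \<phi>_def zc_def
      by (simp add: integral_angle_cos(2)[OF n] integral_Re_holomorphic_times_cos[OF H(1) r n]
           hn[unfolded zc_def])
    finally show ?thesis by (simp add: G_def mult_ac)
  qed
  have "(\<integral>p. L (fst p) (snd p) * (\<phi> (fst p) * \<phi> (snd p)) \<partial>(?M \<Otimes>\<^sub>M ?M))
      = (\<integral>s. (\<integral>t. L s t * (\<phi> s * \<phi> t) \<partial>?M) \<partial>?M)"
    using PM.integral_fst'[OF energy(1)] by simp
  also have "\<dots> = (2 * pi * r ^ n) * (\<integral>s. Re (G (zc s) / zc s ^ n) * \<phi> s \<partial>?M)"
    unfolding inner by (rule integral_mult_right_zero)
  also have "(\<integral>s. Re (G (zc s) / zc s ^ n) * \<phi> s \<partial>?M)
      = pi * r ^ n * Re (cis (- \<alpha>) * (cis (- \<alpha>) * fps_nth (fps_expansion N 0) (2 * n)))"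
    unfolding zc_def \<phi>_def integral_Re_quotient_times_cos[OF G r n]
    by (simp add: G_def[abs_def] fps_nth_expansion_cmult[OF N(1)])
  also have "cis (- \<alpha>) * (cis (- \<alpha>) * fps_nth (fps_expansion N 0) (2 * n))
      = cis (- 2 * \<alpha>) * fps_nth (fps_expansion N 0) (2 * n)"
    by (simp add: cis_mult flip: mult.assoc)
  finally have "2 * pi * r ^ n * (pi * r ^ n * Re (cis (- 2 * \<alpha>) * fps_nth (fps_expansion N 0) (2 * n)))
      \<le> 2 * pi\<^sup>2 / real n"
    using energy(2) by simp
  moreover have "r ^ (2 * n) = r ^ n * r ^ n"
    by (simp only: mult_2 power_add)
  ultimately have "(2 * pi\<^sup>2) * (r ^ (2 * n) * Re (cis (- 2 * \<alpha>) * fps_nth (fps_expansion N 0) (2 * n)))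
      \<le> (2 * pi\<^sup>2) * (1 / real n)"
    by (simp only: power2_eq_square mult_ac times_divide_eq_right mult_1_right)
  then show ?thesis
    by (subst (asm) mult_le_cancel_left_pos) auto
qed

text \<open>
  Here \<open>N(z)/z\<^sup>n\<close> is the \<open>n\<close>-th Taylor coefficient in \<open>w\<close> of \<open>log ((F(w) - F(z))/(w - z))\<close>, so the \<open>2n\<close>-th
  coefficient of \<open>N\<close> is the Grunsky coefficient \<open>h\<^sub>n\<^sub>n\<close>. Passing to \<open>N\<close> lets the hypothesis be verified by
  computations in one variable, for fixed \<open>z \<noteq> 0\<close>, and makes the choice of the logarithm irrelevant.
\<close>

theorem diagonal_grunsky:
  assumes hol: "F holomorphic_on ball 0 1" and inj: "inj_on F (ball 0 1)"
    and N: "N holomorphic_on ball 0 1" "N 0 = 0" and n: "n \<ge> 1"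
    and coeff: "\<And>z H. z \<in> ball 0 1 - {0} \<Longrightarrow> H holomorphic_on ball 0 1 \<Longrightarrow>
      (\<And>w. w \<in> ball 0 1 \<Longrightarrow> exp (H w) * (w - z) = F w - F z) \<Longrightarrow>
      fps_nth (fps_expansion H 0) n * z ^ n = N z"
  shows "cmod (fps_nth (fps_expansion N 0) (2 * n)) \<le> 1 / real n"
proof -
  define \<gamma> where "\<gamma> = fps_nth (fps_expansion N 0) (2 * n)"
  \<comment> \<open>the rotation that makes the coefficient real and nonnegative\<close>
  have "cis (- 2 * (Arg \<gamma> / 2)) * \<gamma> = cis (- Arg \<gamma>) * rcis (cmod \<gamma>) (Arg \<gamma>)"
    by (simp add: rcis_cmod_Arg)
  also have "\<dots> = of_real (cmod \<gamma>)"
    by (simp add: rcis_def cis_mult mult.left_commute)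
  finally have rot: "Re (cis (- 2 * (Arg \<gamma> / 2)) * \<gamma>) = cmod \<gamma>" by simp
  have le: "r ^ (2 * n) * cmod \<gamma> \<le> 1 / real n" if "0 < r" "r < 1" for r
    using diagonal_grunsky_on_circle[OF hol inj N n coeff that, of "Arg \<gamma> / 2", folded \<gamma>_def]
    unfolding rot .
  have "((\<lambda>r. r ^ (2 * n) * cmod \<gamma>) \<longlongrightarrow> 1 ^ (2 * n) * cmod \<gamma>) (at_left (1::real))"
    by (intro tendsto_intros)
  moreover have "eventually (\<lambda>r. r ^ (2 * n) * cmod \<gamma> \<le> 1 / real n) (at_left (1::real))"
    using eventually_at_left_real[of 0 "1::real"] by (auto elim!: eventually_mono intro: le)
  ultimately have "1 ^ (2 * n) * cmod \<gamma> \<le> 1 / real n"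
    by (rule tendsto_upperbound) simp
  then show ?thesis by (simp add: \<gamma>_def)
qed

section \<open>Two Grunsky coefficients in closed form\<close>

lemma fps_mult_nth_2:
  fixes A B :: "'a::comm_ring_1 fps"
  shows "fps_nth (A * B) 2 = fps_nth A 0 * fps_nth B 2 + fps_nth A 1 * fps_nth B 1 + fps_nth A 2 * fps_nth B 0"
  by (simp add: fps_mult_nth numeral_2_eq_2)

lemma fps_mult_nth_3:
  fixes A B :: "'a::comm_ring_1 fps"
  shows "fps_nth (A * B) 3 = fps_nth A 0 * fps_nth B 3 + fps_nth A 1 * fps_nth B 2
    + fps_nth A 2 * fps_nth B 1 + fps_nth A 3 * fps_nth B 0"
  by (simp add: fps_mult_nth numeral_3_eq_3 numeral_2_eq_2)

lemmas fps_mult_nth_low = fps_mult_nth_0 fps_mult_nth_1 fps_mult_nth_2 fps_mult_nth_3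

lemma fps_nth_deriv_low:
  "fps_nth (fps_deriv A) 0 = fps_nth A 1"
  "fps_nth (fps_deriv A) 1 = 2 * fps_nth A 2"
  "fps_nth (fps_deriv A) 2 = 3 * fps_nth A 3"
  by (simp_all add: numeral_2_eq_2 numeral_3_eq_3)

lemma fps_nth_fps_X_low:
  "fps_nth fps_X 0 = 0" "fps_nth fps_X 1 = 1" "fps_nth fps_X 2 = 0" "fps_nth fps_X 3 = 0"
  by (simp_all add: fps_X_def)

lemma holomorphic_disk_has_fps:
  "f holomorphic_on ball 0 1 \<Longrightarrow> f has_fps_expansion fps_expansion f 0"
  by (rule has_fps_expansion_fps_expansion[of "ball 0 1"]) auto

lemma fps_expansion_eqI:
  fixes f :: "complex \<Rightarrow> complex"
  assumes "f has_fps_expansion A"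
  shows "fps_expansion f 0 = A"
  by (rule fps_ext) (simp add: fps_expansion_def fps_nth_fps_expansion[OF assms])

text \<open>
  The logarithmic derivative removes the exponential, so that coefficients of a logarithm can be found by
  comparing coefficients of power series.
\<close>

lemma fps_deriv_of_exp:
  fixes G :: "complex \<Rightarrow> complex"
  assumes G: "G has_fps_expansion g" and e: "(\<lambda>z. exp (G z)) has_fps_expansion e"
  shows "fps_deriv e = fps_deriv g * e"
proof -
  obtain s where s: "open s" "0 \<in> s" "G holomorphic_on s"
    using has_fps_expansion_imp_holomorphic[OF G] by metis
  have "deriv (\<lambda>z. exp (G z)) has_fps_expansion fps_deriv e"
    by (rule has_fps_expansion_deriv[OF e])
  moreover have "eventually (\<lambda>z. deriv (\<lambda>z. exp (G z)) z = deriv G z * exp (G z)) (nhds 0)"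
    using eventually_nhds_in_open[OF s(1,2)]
  proof eventually_elim
    case (elim z)
    then have "(G has_field_derivative deriv G z) (at z)"
      using holomorphic_derivI[OF s(3,1)] by blast
    then have "((\<lambda>z. exp (G z)) has_field_derivative exp (G z) * deriv G z) (at z)"
      by (rule DERIV_chain2[OF DERIV_exp])
    then show ?case by (simp add: DERIV_imp_deriv mult.commute)
  qed
  ultimately have "(\<lambda>z. deriv G z * exp (G z)) has_fps_expansion fps_deriv e"
    using has_fps_expansion_cong by fastforce
  moreover have "(\<lambda>z. deriv G z * exp (G z)) has_fps_expansion fps_deriv g * e"
    by (intro has_fps_expansion_mult has_fps_expansion_deriv G e)
  ultimately show ?thesis
    by (rule fps_expansion_unique_complex)
qed

text \<open>
  The linear equation for \<open>H'\<close> obtained by differentiating \<open>exp (H(w)) (w - z) = F(w) - F(z)\<close> in \<open>w\<close>.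
\<close>

lemma difference_quotient_log_fps:
  assumes F: "F holomorphic_on ball 0 1" and H: "H holomorphic_on ball 0 1"
    and eq: "\<And>w. w \<in> ball 0 1 \<Longrightarrow> exp (H w) * (w - z) = F w - F z"
  defines "h \<equiv> fps_deriv (fps_expansion H 0)"
    and "\<Phi> \<equiv> fps_expansion F 0"
  shows "h * (\<Phi> - fps_const (F z)) * (fps_X - fps_const z)
    = fps_deriv \<Phi> * (fps_X - fps_const z) - (\<Phi> - fps_const (F z))"
proof -
  define e where "e = fps_expansion (\<lambda>w. exp (H w)) 0"
  have e: "(\<lambda>w. exp (H w)) has_fps_expansion e"
    unfolding e_def by (intro holomorphic_disk_has_fps holomorphic_intros H)
  have h: "fps_deriv e = h * e"
    unfolding h_def by (rule fps_deriv_of_exp[OF holomorphic_disk_has_fps[OF H] e])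
  have "(\<lambda>w. exp (H w) * (w - z)) has_fps_expansion e * (fps_X - fps_const z)"
    by (intro has_fps_expansion_mult e has_fps_expansion_diff has_fps_expansion_fps_X has_fps_expansion_const)
  moreover have "eventually (\<lambda>w. exp (H w) * (w - z) = F w - F z) (nhds 0)"
    using eventually_nhds_in_open[of "ball 0 1" "0::complex"] by (auto elim!: eventually_mono simp: eq)
  ultimately have "(\<lambda>w. F w - F z) has_fps_expansion e * (fps_X - fps_const z)"
    using has_fps_expansion_cong by fastforce
  moreover have "(\<lambda>w. F w - F z) has_fps_expansion \<Phi> - fps_const (F z)"
    unfolding \<Phi>_def by (intro has_fps_expansion_diff has_fps_expansion_const holomorphic_disk_has_fps F)
  ultimately have eq: "e * (fps_X - fps_const z) = \<Phi> - fps_const (F z)"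
    by (rule fps_expansion_unique_complex)
  then have "fps_deriv (e * (fps_X - fps_const z)) = fps_deriv \<Phi>"
    by simp
  then have "h * (e * (fps_X - fps_const z)) + e = fps_deriv \<Phi>"
    by (simp add: h algebra_simps)
  then have "(h * (e * (fps_X - fps_const z)) + e) * (fps_X - fps_const z) = fps_deriv \<Phi> * (fps_X - fps_const z)"
    by simp
  then show ?thesis
    unfolding eq[symmetric] by (simp add: algebra_simps)
qed

lemma fps_expansion_quotient_identity:
  assumes "F holomorphic_on ball 0 1" "p holomorphic_on ball 0 1"
    "\<And>z. z \<in> ball 0 1 \<Longrightarrow> p z * F z = z"
  shows "fps_expansion p 0 * fps_expansion F 0 = fps_X"
proof (rule fps_expansion_unique_complex)
  show "(\<lambda>z. p z * F z) has_fps_expansion fps_expansion p 0 * fps_expansion F 0"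
    by (intro has_fps_expansion_mult holomorphic_disk_has_fps assms)
  have "eventually (\<lambda>z. p z * F z = z) (nhds 0)"
    using eventually_nhds_in_open[of "ball 0 1" "0::complex"] by (auto elim!: eventually_mono simp: assms)
  from has_fps_expansion_cong[OF this refl] show "(\<lambda>z. p z * F z) has_fps_expansion fps_X"
    by (simp add: has_fps_expansion_fps_X)
qed

text \<open>
  The coefficient of \<open>w\<close> in \<open>log ((F(w) - F(z))/(w - z))\<close> is \<open>1/z - 1/F(z)\<close>, which is \<open>(1 - p(z))/z\<close>. So \<open>N = 1 - p\<close> in the
  diagonal Grunsky inequality.
\<close>

lemma grunsky_11:
  assumes F: "F holomorphic_on ball 0 1" "inj_on F (ball 0 1)" "F 0 = 0"
    and p: "p holomorphic_on ball 0 1" "p 0 = 1" "\<And>z. z \<in> ball 0 1 \<Longrightarrow> p z * F z = z"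
  shows "cmod (fps_nth (fps_expansion p 0) 2) \<le> 1"
proof -
  define \<Phi> where "\<Phi> = fps_expansion F 0"
  define P where "P = fps_expansion p 0"
  have P: "p has_fps_expansion P"
    unfolding P_def by (rule holomorphic_disk_has_fps[OF p(1)])
  have prod: "P * \<Phi> = fps_X"
    unfolding P_def \<Phi>_def by (rule fps_expansion_quotient_identity[OF F(1) p(1,3)])
  have P0: "fps_nth P 0 = 1" and \<Phi>0: "fps_nth \<Phi> 0 = 0"
    by (simp_all add: P_def \<Phi>_def fps_expansion_def p F)
  have \<Phi>1: "fps_nth \<Phi> 1 = 1"
    using arg_cong[OF prod, of "\<lambda>a. fps_nth a 1"] by (simp add: fps_mult_nth_low P0 \<Phi>0)
  have "cmod (fps_nth (fps_expansion (\<lambda>z. 1 - p z) 0) (2 * 1)) \<le> 1 / real 1"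
  proof (rule diagonal_grunsky[OF F(1,2)])
    fix z H
    assume z: "z \<in> ball 0 1 - {0}" and H: "H holomorphic_on ball 0 1"
      and eq: "\<And>w. w \<in> ball 0 1 \<Longrightarrow> exp (H w) * (w - z) = F w - F z"
    have pz: "p z * F z = z" "z \<noteq> 0" using p(3) z by auto
    then have "F z \<noteq> 0" by auto
    have "fps_nth (fps_expansion H 0) 1 * F z * z = F z - z"
      using arg_cong[OF difference_quotient_log_fps[OF F(1) H eq], of "\<lambda>a. fps_nth a 0", folded \<Phi>_def]
      by (simp add: fps_mult_nth_low fps_nth_deriv_low fps_nth_fps_X_low \<Phi>0 \<Phi>1[unfolded One_nat_def])
    then have "(fps_nth (fps_expansion H 0) 1 * z) * F z = (1 - p z) * F z"
      using pz(1) by (simp add: algebra_simps)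
    with \<open>F z \<noteq> 0\<close> show "fps_nth (fps_expansion H 0) 1 * z ^ 1 = 1 - p z"
      by simp
  qed (use p in \<open>auto intro!: holomorphic_intros\<close>)
  moreover have "fps_expansion (\<lambda>z. 1 - p z) 0 = 1 - P"
    by (intro fps_expansion_eqI has_fps_expansion_diff has_fps_expansion_1 P)
  ultimately show ?thesis by (simp add: P_def)
qed

text \<open>
  If the quadratic coefficient of \<open>F\<close> vanishes, the coefficient of \<open>w\<^sup>3\<close> in \<open>log ((F(w) - F(z))/(w - z))\<close> is
  \<open>(1/z\<^sup>3 - 1/F(z)\<^sup>3)/3 - \<alpha>/F(z)\<close> with \<open>\<alpha>\<close> the cubic coefficient of \<open>F\<close>, which is minus the quadratic coefficient of \<open>p\<close>.
\<close>

lemma grunsky_33: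
  assumes F: "F holomorphic_on ball 0 1" "inj_on F (ball 0 1)" "F 0 = 0"
    and p: "p holomorphic_on ball 0 1" "p 0 = 1" "\<And>z. z \<in> ball 0 1 \<Longrightarrow> p z * F z = z"
  defines "P \<equiv> fps_expansion p 0"
  assumes P1: "fps_nth P 1 = 0"
  shows "cmod (fps_nth (fps_expansion (\<lambda>z. (1 - p z ^ 3) / 3 + fps_nth P 2 * p z * z\<^sup>2) 0) 6) \<le> 1 / 3"
proof -
  define \<Phi> where "\<Phi> = fps_expansion F 0"
  have prod: "P * \<Phi> = fps_X"
    unfolding P_def \<Phi>_def by (rule fps_expansion_quotient_identity[OF F(1) p(1,3)])
  have P0: "fps_nth P 0 = 1" and \<Phi>0: "fps_nth \<Phi> 0 = 0"
    by (simp_all add: P_def \<Phi>_def fps_expansion_def p F)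
  have \<Phi>1: "fps_nth \<Phi> 1 = 1"
    using arg_cong[OF prod, of "\<lambda>a. fps_nth a 1"] by (simp add: fps_mult_nth_low P0 \<Phi>0)
  have \<Phi>2: "fps_nth \<Phi> 2 = 0"
    using arg_cong[OF prod, of "\<lambda>a. fps_nth a 2"] P1 
    by (simp add: fps_mult_nth_low P0 \<Phi>0 \<Phi>1 fps_nth_fps_X_low)
  have \<Phi>3: "fps_nth \<Phi> 3 = - fps_nth P 2"
    using arg_cong[OF prod, of "\<lambda>a. fps_nth a 3"] P1 \<Phi>1 \<Phi>2
    by (simp add: fps_mult_nth_low P0 \<Phi>0 fps_nth_fps_X_low eq_neg_iff_add_eq_0)
  have "cmod (fps_nth (fps_expansion (\<lambda>z. (1 - p z ^ 3) / 3 + fps_nth P 2 * p z * z\<^sup>2) 0) (2 * 3)) \<le> 1 / real 3"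
  proof (rule diagonal_grunsky[OF F(1,2)])
    fix z H
    assume z: "z \<in> ball 0 1 - {0}" and H: "H holomorphic_on ball 0 1"
      and eq: "\<And>w. w \<in> ball 0 1 \<Longrightarrow> exp (H w) * (w - z) = F w - F z"
    define y where "y = F z"
    have pz: "p z * y = z" "z \<noteq> 0" using p(3) z by (auto simp: y_def)
    then have nz: "p z \<noteq> 0" "y \<noteq> 0" by auto
    define h where "h = fps_deriv (fps_expansion H 0)"
    note rel = difference_quotient_log_fps[OF F(1) H eq, folded \<Phi>_def h_def y_def]
    note low = fps_mult_nth_low fps_nth_deriv_low fps_nth_fps_X_low \<Phi>0 \<Phi>1 \<Phi>2 \<Phi>3
       fps_sub_nth fps_nth_fps_const
    have 0: "fps_nth h 0 * y * z = y - z"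
      using arg_cong[OF rel, of "\<lambda>a. fps_nth a 0"] by (simp add: low del: One_nat_def)
    have 1: "fps_nth h 1 * y * z = fps_nth h 0 * (y + z)"
      using arg_cong[OF rel, of "\<lambda>a. fps_nth a 1"] by (simp add: low algebra_simps del: One_nat_def)
    have 2: "fps_nth h 2 * y * z = fps_nth h 1 * (y + z) - fps_nth h 0 + 3 * fps_nth P 2 * z"
      using arg_cong[OF rel, of "\<lambda>a. fps_nth a 2"] by (simp add: low algebra_simps del: One_nat_def)
    \<comment> \<open>eliminating the two lower coefficients; dividing by \<open>(y z)\<^sup>3\<close> gives the formula for the third\<close>
    have "fps_nth h 2 * (y * z) ^ 3 = y ^ 3 - z ^ 3 + 3 * fps_nth P 2 * z * (y * z)\<^sup>2"
      using 0 1 2 by algebra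
    then have "(fps_nth h 2 * z ^ 3) * y ^ 3 = (1 - p z ^ 3 + 3 * (fps_nth P 2 * p z * z\<^sup>2)) * y ^ 3"
      using pz(1) by algebra
    then have "fps_nth h 2 * z ^ 3 = 1 - p z ^ 3 + 3 * (fps_nth P 2 * p z * z\<^sup>2)"
      using nz by simp
    moreover have "fps_nth h 2 = 3 * fps_nth (fps_expansion H 0) 3"
      unfolding h_def by (rule fps_nth_deriv_low)
    ultimately show "fps_nth (fps_expansion H 0) 3 * z ^ 3 = (1 - p z ^ 3) / 3 + fps_nth P 2 * p z * z\<^sup>2"
      by (simp add: field_simps)
  qed (use p in \<open>auto intro!: holomorphic_intros\<close>)
  then show ?thesis by simp
qed

section \<open>Logarithmic coefficients of the inverse\<close>

lemma class_S_D:
  assumes "f \<in> class_S"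
  shows "f holomorphic_on ball 0 1" "inj_on f (ball 0 1)" "f 0 = 0" "deriv f 0 = 1"
  using assms by (auto simp: class_S_def class_A_def)

lemma class_S_quotient:
  assumes "f \<in> class_S"
  obtains p where "p holomorphic_on ball 0 1" "p 0 = 1"
    "\<And>z. z \<in> ball 0 1 \<Longrightarrow> p z * f z = z" "\<And>z. z \<in> ball 0 1 \<Longrightarrow> p z \<noteq> 0"
proof -
  note f = class_S_D[OF assms]
  define K where "K = (\<lambda>w. if w = 0 then deriv f 0 else (f w - f 0) / (w - 0))"
  have K: "K holomorphic_on ball 0 1" "\<And>w. w \<in> ball 0 1 \<Longrightarrow> K w \<noteq> 0"
    unfolding K_def using difference_quotient_holomorphic[OF f(1,2), of 0] by auto
  show ?thesis
  proof (rule that)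
    show "(\<lambda>z. 1 / K z) holomorphic_on ball 0 1"
      by (rule holomorphic_on_divide[OF holomorphic_on_const K])
    show "1 / K z * f z = z" "1 / K z \<noteq> 0" if "z \<in> ball 0 1" for z
      using K(2)[OF that] f by (auto simp: K_def split: if_splits)
  qed (simp add: K_def f)
qed

text \<open>
  Near \<open>0\<close> the series of \<open>log (f\<^sup>-\<^sup>1(w)/w)\<close> composed with \<open>f\<close> is a logarithm of \<open>p\<close>; the series of \<open>f\<close> itself is eliminated
  through \<open>p(z) f(z) = z\<close>.
\<close>

lemma inv_log_coeff_formulas:
  assumes f: "f \<in> class_S"
    and p: "p holomorphic_on ball 0 1" "p 0 = 1" "\<And>z. z \<in> ball 0 1 \<Longrightarrow> p z * f z = z"
  defines "P \<equiv> fps_expansion p 0"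
  shows "2 * inv_log_coeff f 1 = fps_nth P 1"
    and "4 * inv_log_coeff f 2 = fps_nth P 1 ^ 2 + 2 * fps_nth P 2"
    and "6 * inv_log_coeff f 3 = fps_nth P 1 ^ 3 + 6 * fps_nth P 1 * fps_nth P 2 + 3 * fps_nth P 3"
proof -
  note fS = class_S_D[OF f]
  define \<Phi> where "\<Phi> = fps_expansion f 0"
  define l where "l = fps_expansion (log_inverse_quot f) 0"
  have prod: "P * \<Phi> = fps_X"
    unfolding P_def \<Phi>_def by (rule fps_expansion_quotient_identity[OF fS(1) p(1,3)])
  have P: "p has_fps_expansion P" and \<Phi>: "f has_fps_expansion \<Phi>"
    unfolding P_def \<Phi>_def by (intro holomorphic_disk_has_fps p fS)+
  have l: "log_inverse_quot f has_fps_expansion l"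
    unfolding l_def using analytic_at_imp_has_fps_expansion_0[OF log_inverse_quot_analytic[OF f]] .
  have P0: "fps_nth P 0 = 1" and \<Phi>0: "fps_nth \<Phi> 0 = 0" and l0: "fps_nth l 0 = 0"
    by (simp_all add: P_def \<Phi>_def l_def fps_expansion_def p fS log_inverse_quot_def)
  have comp: "(\<lambda>z. log_inverse_quot f (f z)) has_fps_expansion (l oo \<Phi>)"
    using has_fps_expansion_compose[OF l \<Phi> \<Phi>0] by (simp add: o_def)
  have "exp (log_inverse_quot f (f z)) = p z" if z: "z \<in> ball 0 1" for z
  proof (cases "z = 0")
    case True
    then show ?thesis by (simp add: fS p log_inverse_quot_def)
  next
    case False
    then have fz: "f z \<noteq> 0" using p(3)[OF z] by auto
    have "disk_inverse f (f z) = z"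
      unfolding disk_inverse_def by (rule inv_into_f_f[OF fS(2) z])
    then have "exp (log_inverse_quot f (f z)) = z / f z"
      using False fz by (simp add: log_inverse_quot_def)
    also have "\<dots> = p z" using p(3)[OF z] fz by (simp add: field_simps)
    finally show ?thesis .
  qed
  then have "eventually (\<lambda>z. p z = exp (log_inverse_quot f (f z))) (nhds 0)"
    using eventually_nhds_in_open[of "ball 0 1" "0::complex"] by (auto elim!: eventually_mono)
  from has_fps_expansion_cong[OF this refl] P
  have "(\<lambda>z. exp (log_inverse_quot f (f z))) has_fps_expansion P" by simp
  from fps_deriv_of_exp[OF comp this]
  have rel: "fps_deriv P = fps_deriv (l oo \<Phi>) * P" .
  have \<Phi>1: "fps_nth \<Phi> 1 = 1"
    using arg_cong[OF prod, of "\<lambda>a. fps_nth a 1"] by (simp add: fps_mult_nth_low P0 \<Phi>0)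
  have \<Phi>2: "fps_nth \<Phi> 2 = - fps_nth P 1"
    using arg_cong[OF prod, of "\<lambda>a. fps_nth a 2"] \<Phi>1
    by (simp add: fps_mult_nth_low P0 \<Phi>0 fps_nth_fps_X_low eq_neg_iff_add_eq_0)
  have \<Phi>3: "fps_nth \<Phi> 3 = fps_nth P 1 ^ 2 - fps_nth P 2"
    using arg_cong[OF prod, of "\<lambda>a. fps_nth a 3"] \<Phi>1 \<Phi>2
    by (simp add: fps_mult_nth_low P0 \<Phi>0 fps_nth_fps_X_low power2_eq_square algebra_simps)
  have pow2: "\<Phi> ^ 2 = \<Phi> * \<Phi>" and pow3: "\<Phi> ^ 3 = \<Phi> * (\<Phi> * \<Phi>)"
    by (simp_all add: power2_eq_square power3_eq_cube mult.assoc)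
  note low = fps_mult_nth_low \<Phi>0 \<Phi>1 \<Phi>2 \<Phi>3
  have sum2: "sum g {0..2} = g 0 + g 1 + g 2" and sum3: "sum g {0..3} = g 0 + g 1 + g 2 + g 3"
    for g :: "nat \<Rightarrow> complex"
    by (simp_all add: numeral_2_eq_2 numeral_3_eq_3)
  have c1: "fps_nth (l oo \<Phi>) 1 = fps_nth l 1"
    using \<Phi>1 by (simp add: fps_compose_nth l0)
  have c2: "fps_nth (l oo \<Phi>) 2 = fps_nth l 1 * fps_nth \<Phi> 2 + fps_nth l 2"
    unfolding fps_compose_nth sum2 pow2 power_one_right by (simp add: low l0 del: One_nat_def)
  have c3: "fps_nth (l oo \<Phi>) 3 = fps_nth l 1 * fps_nth \<Phi> 3 + 2 * fps_nth l 2 * fps_nth \<Phi> 2 + fps_nth l 3"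
    unfolding fps_compose_nth sum3 pow2 pow3 power_one_right by (simp add: low l0 del: One_nat_def)
  have r0: "fps_nth P 1 = fps_nth l 1"
    using arg_cong[OF rel, of "\<lambda>a. fps_nth a 0"]
    by (simp only: fps_mult_nth_low fps_nth_deriv_low P0 c1 mult_1_right)
  have r1: "2 * fps_nth P 2 = 2 * fps_nth (l oo \<Phi>) 2 + fps_nth l 1 * fps_nth P 1"
    using arg_cong[OF rel, of "\<lambda>a. fps_nth a 1"]
    by (simp only: fps_mult_nth_low fps_nth_deriv_low P0 c1 mult_1_right add.commute)
  have r2: "3 * fps_nth P 3 = 3 * fps_nth (l oo \<Phi>) 3 + 2 * fps_nth (l oo \<Phi>) 2 * fps_nth P 1 + fps_nth l 1 * fps_nth P 2"
    using arg_cong[OF rel, of "\<lambda>a. fps_nth a 2"]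
    by (simp only: fps_mult_nth_low fps_nth_deriv_low P0 c1 mult_1_right mult_1_left ac_simps)
  have \<Gamma>: "fps_nth l k = 2 * inv_log_coeff f k" for k
    by (simp add: inv_log_coeff_def l_def)
  show "2 * inv_log_coeff f 1 = fps_nth P 1"
    using r0 \<Gamma>[of 1] by simp
  have l2: "2 * fps_nth l 2 = fps_nth P 1 ^ 2 + 2 * fps_nth P 2"
    using r1 unfolding c2 \<Phi>2 r0[symmetric] by (simp add: power2_eq_square algebra_simps)
  then show "4 * inv_log_coeff f 2 = fps_nth P 1 ^ 2 + 2 * fps_nth P 2"
    by (simp add: \<Gamma>)
  have "3 * fps_nth l 3 = 3 * fps_nth P 3 - fps_nth P 1 ^ 3 + 2 * (fps_nth P 1 * fps_nth P 2)
      + 2 * fps_nth P 1 * (2 * fps_nth l 2)"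
    using r2 unfolding c2 c3 \<Phi>2 \<Phi>3 r0[symmetric]
    by (simp add: power2_eq_square power3_eq_cube algebra_simps)
  also have "\<dots> = fps_nth P 1 ^ 3 + 6 * fps_nth P 1 * fps_nth P 2 + 3 * fps_nth P 3"
    unfolding l2 by (simp add: power2_eq_square power3_eq_cube algebra_simps)
  finally show "6 * inv_log_coeff f 3 = fps_nth P 1 ^ 3 + 6 * fps_nth P 1 * fps_nth P 2 + 3 * fps_nth P 3"
    by (simp add: \<Gamma>)
qed

section \<open>The square root transform and the coefficient bounds\<close>

lemma holomorphic_sqrt_disk:
  assumes p: "p holomorphic_on ball 0 1" "p 0 = 1" "\<And>z. z \<in> ball 0 1 \<Longrightarrow> p z \<noteq> 0"
  obtains v where "v holomorphic_on ball 0 1" "v 0 = 1" "\<And>z. z \<in> ball 0 1 \<Longrightarrow> v z ^ 2 = p z"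
    "\<And>z. z \<in> ball 0 1 \<Longrightarrow> v z \<noteq> 0"
proof -
  obtain g where g: "g holomorphic_on ball 0 1" "\<And>z. z \<in> ball 0 1 \<Longrightarrow> exp (g z) = p z"
    using holomorphic_logarithm_exists[OF convex_ball open_ball p(1) p(3), of 0] by auto
  have g0: "exp (g 0) = 1" using g(2)[of 0] p(2) by simp
  show ?thesis
  proof (rule that)
    show "(\<lambda>z. exp ((g z - g 0) / 2)) holomorphic_on ball 0 1"
      by (intro holomorphic_intros g) auto
    show "exp ((g z - g 0) / 2) ^ 2 = p z" if "z \<in> ball 0 1" for z
    proof -
      have "exp ((g z - g 0) / 2) ^ 2 = exp (g z - g 0)"
        by (simp add: power2_eq_square flip: exp_add)
      then show ?thesis using g(2)[OF that] g0 by (simp add: exp_diff)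
    qed
  qed auto
qed

text \<open>
  The function \<open>F\<close> satisfies \<open>F(z)\<^sup>2 = f(z\<^sup>2)\<close>, so \<open>F(z) = F(w)\<close> forces \<open>z = \<plusminus> w\<close>; since \<open>F\<close> is odd and vanishes only at \<open>0\<close>, the
  sign must be plus.
\<close>

lemma square_root_transform:
  assumes f: "f \<in> class_S"
    and p: "\<And>z. z \<in> ball 0 1 \<Longrightarrow> p z * f z = z"
    and v: "v holomorphic_on ball 0 1" "v 0 = 1" "\<And>z. z \<in> ball 0 1 \<Longrightarrow> v z ^ 2 = p z"
      "\<And>z. z \<in> ball 0 1 \<Longrightarrow> v z \<noteq> 0"
  defines "F \<equiv> \<lambda>z. z / v (z\<^sup>2)"
  shows "F holomorphic_on ball 0 1" "inj_on F (ball 0 1)" "F 0 = 0"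
    "(\<lambda>z. v (z\<^sup>2)) holomorphic_on ball 0 1" "\<And>z. z \<in> ball 0 1 \<Longrightarrow> v (z\<^sup>2) * F z = z"
proof -
  have sq: "z\<^sup>2 \<in> ball 0 1" if "z \<in> ball 0 1" for z :: complex
    using that by (simp add: norm_power power_less_one_iff)
  show hol: "(\<lambda>z. v (z\<^sup>2)) holomorphic_on ball 0 1"
    using holomorphic_on_compose_gen[of "\<lambda>z. z\<^sup>2" "ball 0 1" v "ball 0 1"] v(1) sq
    by (force simp: o_def intro!: holomorphic_intros)
  show "F holomorphic_on ball 0 1"
    unfolding F_def by (intro holomorphic_on_divide holomorphic_on_ident hol v(4) sq)
  show "F 0 = 0" by (simp add: F_def)
  show quot: "v (z\<^sup>2) * F z = z" if "z \<in> ball 0 1" for z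
    using v(4)[OF sq[OF that]] by (simp add: F_def)
  show "inj_on F (ball 0 1)"
  proof (rule inj_onI)
    fix z w :: complex
    assume z: "z \<in> ball 0 1" and w: "w \<in> ball 0 1" and eq: "F z = F w"
    have F_sq: "(F u)\<^sup>2 = f (u\<^sup>2)" if u: "u \<in> ball 0 1" for u
    proof -
      have "p (u\<^sup>2) * (F u)\<^sup>2 = p (u\<^sup>2) * f (u\<^sup>2)"
        using p[OF sq[OF u]] v(3)[OF sq[OF u]] quot[OF u] by (metis power_mult_distrib)
      moreover have "p (u\<^sup>2) \<noteq> 0" using v(3,4)[OF sq[OF u]] by auto
      ultimately show ?thesis by simp
    qed
    have "f (z\<^sup>2) = f (w\<^sup>2)" using F_sq[OF z] F_sq[OF w] eq by simp
    then have "z\<^sup>2 = w\<^sup>2"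
      using class_S_D(2)[OF f] sq[OF z] sq[OF w] by (auto dest: inj_onD)
    then consider "z = w" | "z = - w" by (auto simp: power2_eq_iff)
    then show "z = w"
    proof cases
      case 2
      then have "F z = - F z" using eq by (simp add: F_def)
      then have "F z = 0" by simp
      then have "z = 0" using quot[OF z] by simp
      with 2 show ?thesis by simp
    qed
  qed
qed

text \<open>
  With \<open>v = 1 + c\<^sub>1 z + c\<^sub>2 z\<^sup>2 + c\<^sub>3 z\<^sup>3 + \<dots>\<close> a square root of \<open>p\<close>, the square root transform has quotient \<open>v(z\<^sup>2)\<close>. Its Grunsky
  coefficients are \<open>h\<^sub>1\<^sub>1 = -c\<^sub>1\<close> and \<open>h\<^sub>3\<^sub>3 = -(c\<^sub>3 + c\<^sub>1 c\<^sub>2 + c\<^sub>1\<^sup>3/3)\<close>, and the latter is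
  \<open>-(12 b\<^sub>2 + b\<^sub>0\<^sup>3)/24\<close>.
\<close>

lemma quotient_coefficient_bounds:
  assumes f: "f \<in> class_S"
    and p: "p holomorphic_on ball 0 1" "p 0 = 1" "\<And>z. z \<in> ball 0 1 \<Longrightarrow> p z * f z = z"
      "\<And>z. z \<in> ball 0 1 \<Longrightarrow> p z \<noteq> 0"
  defines "P \<equiv> fps_expansion p 0"
  shows "cmod (fps_nth P 1) \<le> 2" "cmod (fps_nth P 2) \<le> 1"
    "cmod (12 * fps_nth P 3 + fps_nth P 1 ^ 3) \<le> 8"
proof -
  show "cmod (fps_nth P 2) \<le> 1"
    unfolding P_def by (rule grunsky_11[OF class_S_D(1,2,3)[OF f] p(1-3)])
  obtain v where v: "v holomorphic_on ball 0 1" "v 0 = 1" "\<And>z. z \<in> ball 0 1 \<Longrightarrow> v z ^ 2 = p z"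
    "\<And>z. z \<in> ball 0 1 \<Longrightarrow> v z \<noteq> 0"
    using holomorphic_sqrt_disk[OF p(1,2,4)] by blast
  define V where "V = fps_expansion v 0"
  have V: "v has_fps_expansion V" unfolding V_def by (rule holomorphic_disk_has_fps[OF v(1)])
  have V0: "fps_nth V 0 = 1" by (simp add: V_def fps_expansion_def v)
  have PV: "P = V * V"
  proof (rule fps_expansion_unique_complex)
    show "p has_fps_expansion P" unfolding P_def by (rule holomorphic_disk_has_fps[OF p(1)])
    have "eventually (\<lambda>z. p z = v z * v z) (nhds 0)"
      using eventually_nhds_in_open[of "ball 0 1" "0::complex"]
      by (auto elim!: eventually_mono simp: v(3)[symmetric] power2_eq_square)
    from has_fps_expansion_cong[OF this refl] show "p has_fps_expansion V * V"
      using has_fps_expansion_mult[OF V V] by simp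
  qed
  have P1: "fps_nth P 1 = 2 * fps_nth V 1"
    and P3: "fps_nth P 3 = 2 * fps_nth V 3 + 2 * fps_nth V 1 * fps_nth V 2"
    unfolding PV fps_mult_nth_low V0 by simp_all
  note F = square_root_transform[OF f p(3) v]
  have sq: "(\<lambda>z::complex. z\<^sup>2) has_fps_expansion fps_X ^ 2"
    by (intro fps_expansion_intros)
  have comp_sq: "fps_expansion (\<lambda>z. m (z\<^sup>2)) 0 = fps_compose A (fps_X ^ 2)" if "m has_fps_expansion A" for m A
    using has_fps_expansion_compose[OF that sq] by (intro fps_expansion_eqI) (simp add: o_def)
  have nth_sq: "fps_nth (fps_compose A (fps_X ^ 2)) (2 * k) = fps_nth A k" for A :: "complex fps" and k
    by (simp add: fps_nth_compose_X_power)
  have odd: "fps_nth (fps_compose A (fps_X ^ 2)) 1 = 0" for A :: "complex fps"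
    by (simp add: fps_nth_compose_X_power)
  have V1: "fps_nth (fps_compose V (fps_X ^ 2)) 2 = fps_nth V 1"
    using nth_sq[of V 1] by simp
  have "cmod (fps_nth V 1) \<le> 1"
    using grunsky_11[OF F(1-4) _ F(5)] v(2) unfolding comp_sq[OF V] V1 by simp
  then show "cmod (fps_nth P 1) \<le> 2" unfolding P1 norm_mult by simp
  define m where "m z = (1 - v z ^ 3) / 3 + fps_nth V 1 * v z * z" for z
  define A where "A = fps_const (1 / 3) * (1 - V * V * V) + fps_const (fps_nth V 1) * V * fps_X"
  have "(\<lambda>z. 1 / 3 * (1 - v z * v z * v z) + fps_nth V 1 * v z * z) has_fps_expansion A"
    unfolding A_def by (intro fps_expansion_intros V)
  then have A: "m has_fps_expansion A"
    by (simp add: m_def[abs_def] power3_eq_cube mult.assoc)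
  have "cmod (fps_nth (fps_expansion (\<lambda>z. m (z\<^sup>2)) 0) 6) \<le> 1 / 3"
    unfolding m_def using grunsky_33[OF F(1-4) _ F(5)] v(2) odd unfolding comp_sq[OF V] V1 by simp
  also have "fps_nth (fps_expansion (\<lambda>z. m (z\<^sup>2)) 0) 6 = fps_nth A 3"
    unfolding comp_sq[OF A] using nth_sq[of A 3] by simp
  also have "fps_nth A 3 = - (fps_nth V 3 + fps_nth V 1 * fps_nth V 2 + fps_nth V 1 ^ 3 / 3)"
    unfolding A_def by (simp add: fps_mult_nth_low V0 fps_nth_fps_X_low power3_eq_cube field_simps del: One_nat_def)
  finally have "cmod (fps_nth V 3 + fps_nth V 1 * fps_nth V 2 + fps_nth V 1 ^ 3 / 3) \<le> 1 / 3"
    by (simp only: norm_minus_cancel)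
  moreover have "12 * fps_nth P 3 + fps_nth P 1 ^ 3
      = 24 * (fps_nth V 3 + fps_nth V 1 * fps_nth V 2 + fps_nth V 1 ^ 3 / 3)"
    unfolding P1 P3 by (simp add: power3_eq_cube algebra_simps)
  ultimately show "cmod (12 * fps_nth P 3 + fps_nth P 1 ^ 3) \<le> 8"
    by (simp only: norm_mult norm_numeral)
qed

lemma inv_log_coeff_bounds:
  assumes "f \<in> class_S"
  shows "cmod (inv_log_coeff f 1) \<le> 1" "cmod (inv_log_coeff f 2) \<le> 3 / 2"
    "cmod (inv_log_coeff f 3) \<le> 10 / 3"
proof -
  obtain p where p: "p holomorphic_on ball 0 1" "p 0 = 1"
    "\<And>z. z \<in> ball 0 1 \<Longrightarrow> p z * f z = z" "\<And>z. z \<in> ball 0 1 \<Longrightarrow> p z \<noteq> 0"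
    using class_S_quotient[OF assms] by blast
  define b0 b1 b2 where "b0 = fps_nth (fps_expansion p 0) 1" and "b1 = fps_nth (fps_expansion p 0) 2"
    and "b2 = fps_nth (fps_expansion p 0) 3"
  note \<Gamma> = inv_log_coeff_formulas[OF assms p(1-3), folded b0_def b1_def b2_def]
  note b = quotient_coefficient_bounds[OF assms p, folded b0_def b1_def b2_def]
  have b0_pow: "cmod (b0 ^ k) \<le> 2 ^ k" for k
    unfolding norm_power using b(1) by (intro power_mono) auto
  have "2 * cmod (inv_log_coeff f 1) = cmod b0"
    using arg_cong[OF \<Gamma>(1), of cmod] by (simp add: norm_mult)
  then show "cmod (inv_log_coeff f 1) \<le> 1" using b(1) by simp
  have "4 * cmod (inv_log_coeff f 2) = cmod (b0 ^ 2 + 2 * b1)"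
    using arg_cong[OF \<Gamma>(2), of cmod] by (simp add: norm_mult)
  also have "\<dots> \<le> cmod (b0 ^ 2) + 2 * cmod b1"
    by (rule order_trans[OF norm_triangle_ineq]) (simp add: norm_mult)
  finally show "cmod (inv_log_coeff f 2) \<le> 3 / 2" using b0_pow[of 2] b(2) by simp
  have "6 * cmod (inv_log_coeff f 3) = cmod (b0 ^ 3 + 6 * b0 * b1 + 3 * b2)"
    using arg_cong[OF \<Gamma>(3), of cmod] by (simp add: norm_mult)
  \<comment> \<open>the weight \<open>1/4\<close> makes the coefficient of \<open>b2\<close> agree; what remains has the sharp bound \<open>6 + 12\<close>\<close>
  also have "b0 ^ 3 + 6 * b0 * b1 + 3 * b2 = (12 * b2 + b0 ^ 3) / 4 + (3 / 4 * b0 ^ 3 + 6 * (b0 * b1))"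
    by (simp add: field_simps)
  also have "cmod \<dots> \<le> cmod (12 * b2 + b0 ^ 3) / 4 + (3 / 4 * cmod (b0 ^ 3) + 6 * (cmod b0 * cmod b1))"
    by (intro norm_triangle_mono) (simp_all add: norm_divide norm_mult)
  also have "\<dots> \<le> 8 / 4 + (3 / 4 * 2 ^ 3 + 6 * (2 * 1))"
    using b b0_pow[of 3] by (intro add_mono mult_mono divide_right_mono) auto
  finally show "cmod (inv_log_coeff f 3) \<le> 10 / 3" by simp
qed

section \<open>The Koebe function and sharpness\<close>

definition koebe :: "complex \<Rightarrow> complex"
  where "koebe z = z / (1 - z)\<^sup>2"

lemma koebe_class_S: "koebe \<in> class_S"
proof -
  have nz: "1 - z \<noteq> 0" if "z \<in> ball 0 1" for z :: complex using that by auto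
  have "koebe holomorphic_on ball 0 1"
    unfolding koebe_def[abs_def] using nz by (intro holomorphic_intros) auto
  moreover have "(koebe has_field_derivative 1) (at 0)"
    unfolding koebe_def[abs_def] by (auto intro!: derivative_eq_intros)
  moreover have "inj_on koebe (ball 0 1)"
  proof (rule inj_onI)
    fix z w :: complex
    assume zw: "z \<in> ball 0 1" "w \<in> ball 0 1" and eq: "koebe z = koebe w"
    then have "z * (1 - w)\<^sup>2 = w * (1 - z)\<^sup>2"
      using nz[OF zw(1)] nz[OF zw(2)] by (simp add: koebe_def frac_eq_eq)
    then have "(z - w) * (1 - z * w) = 0"
      by (simp add: power2_eq_square algebra_simps)
    moreover have "cmod (z * w) < 1 * 1"
      unfolding norm_mult using zw by (intro mult_strict_mono) auto
    then have "1 - z * w \<noteq> 0" by auto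
    ultimately show "z = w" by simp
  qed
  ultimately show ?thesis
    by (simp add: class_S_def class_A_def DERIV_imp_deriv koebe_def)
qed

lemma koebe_inv_log_coeff:
  "inv_log_coeff koebe 1 = -1" "inv_log_coeff koebe 2 = 3 / 2" "inv_log_coeff koebe 3 = - 10 / 3"
proof -
  have "(\<lambda>z::complex. (1 - z) * (1 - z)) has_fps_expansion (1 - fps_X) * (1 - fps_X)"
    by (intro fps_expansion_intros)
  then have "fps_expansion (\<lambda>z::complex. (1 - z)\<^sup>2) 0 = (1 - fps_X) * (1 - fps_X)"
    by (intro fps_expansion_eqI) (simp add: power2_eq_square)
  then have nth: "fps_nth (fps_expansion (\<lambda>z::complex. (1 - z)\<^sup>2) 0) 1 = -2"
    "fps_nth (fps_expansion (\<lambda>z::complex. (1 - z)\<^sup>2) 0) 2 = 1"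
    "fps_nth (fps_expansion (\<lambda>z::complex. (1 - z)\<^sup>2) 0) 3 = 0"
    by (simp_all only: fps_mult_nth_low fps_sub_nth fps_nth_fps_X_low) simp_all
  have hol: "(\<lambda>z. (1 - z)\<^sup>2) holomorphic_on ball (0::complex) 1" by (intro holomorphic_intros)
  have quot: "(1 - z)\<^sup>2 * koebe z = z" if "z \<in> ball 0 1" for z :: complex
    using that by (auto simp: koebe_def)
  note \<Gamma> = inv_log_coeff_formulas[OF koebe_class_S hol _ quot, unfolded nth, simplified]
  show "inv_log_coeff koebe 1 = -1" using \<Gamma>(1) by simp
  show "inv_log_coeff koebe 2 = 3 / 2" using \<Gamma>(2) by (simp add: field_simps)
  show "inv_log_coeff koebe 3 = - 10 / 3" using \<Gamma>(3) by (simp add: field_simps)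
qed

theorem theorem1:
  shows "((\<forall>f\<in>class_S. norm (inv_log_coeff f 1) \<le> 1) \<and>
          (\<exists>f\<in>class_S. norm (inv_log_coeff f 1) = 1)) \<and>
         ((\<forall>f\<in>class_S. norm (inv_log_coeff f 2) \<le> 3 / 2) \<and>
          (\<exists>f\<in>class_S. norm (inv_log_coeff f 2) = 3 / 2)) \<and>
         ((\<forall>f\<in>class_S. norm (inv_log_coeff f 3) \<le> 10 / 3) \<and>
          (\<exists>f\<in>class_S. norm (inv_log_coeff f 3) = 10 / 3))"
proof (intro conjI ballI)
  show "\<exists>f\<in>class_S. norm (inv_log_coeff f 1) = 1" "\<exists>f\<in>class_S. norm (inv_log_coeff f 2) = 3 / 2"
    "\<exists>f\<in>class_S. norm (inv_log_coeff f 3) = 10 / 3"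
    by (rule bexI[OF _ koebe_class_S], simp add: koebe_inv_log_coeff norm_divide del: One_nat_def)+
qed (fact inv_log_coeff_bounds)+

end
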